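(* (Ward identity.) Fix $\varepsilon>0$, $M\gg1$, $T>0$, a point $x\in\Lambda_\varepsilon^M$ and a time $t>-T$. Define a vector field $\mathcal V^\varepsilon=(\mathcal V^\varepsilon_1,\mathcal V^\varepsilon_2)$ on the edges of $\Lambda^M_\varepsilon$ by, for $y\in\Lambda^M_\varepsilon$ and $\ell\in\{1,2\}$, $$\begin{aligned}\mathcal V^\varepsilon(y,y+\mathbf e_\ell)=&-\sum_{k}\delta(y-x)\,\mathbf E\big[\psi_k^\varepsilon(t,y+\mathbf e_\ell)\psi_k^\varepsilon(t,y)\big]\\&-\sum_{\mathbf e\in\{0,\mathbf e_\ell\}}\sum_{k,j}\int_{-T}^\infty\nabla_j^\varepsilon P_M^\varepsilon(t-s,x-y-\mathbf e)\,\mathbf E\big[\nabla^\varepsilon_\ell\psi^\varepsilon_k(s,y)\,\psi^\varepsilon_k(t,x)\big]\,ds\\&+\sum_{\mathbf e\in\{0,\mathbf e_\ell\}}\sum_{k,j}\int_{-T}^\infty P_M^\varepsilon(t-s,x-y-\mathbf e)\,\mathbf E\big[\nabla^\varepsilon_\ell\psi^\varepsilon_k(s,y)\,\nabla^\varepsilon_j\psi^\varepsilon_k(t,x)\big]\,ds,\end{aligned}$$ and a function $\mathcal U^\varepsilon=\sum_{j}\mathcal U^\varepsilon_j$ on $\Lambda_\varepsilon^M$ by $$\mathcal U_j^\varepsilon(y)=\sum_{k}\int_{-T}^\infty\Big(P_M^\varepsilon(t-s,x-y)\,\mathbf E\big[\psi_k^\varepsilon(s,y)\nabla_j^\varepsilon\psi_k^\varepsilon(t,x)\big]-\nabla_j^\varepsilon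 P_M^\varepsilon(t-s,x-y)\,\mathbf E\big[\psi_k^\varepsilon(s,y)\psi_k^\varepsilon(t,x)\big]\Big)ds,$$ where $j,k$ are summed over $\{1,2\}$. Then $$(\mathrm{div}^\varepsilon\mathcal V^\varepsilon)(t,y)+\Delta^\varepsilon\mathcal U^\varepsilon(t,y)=0\qquad\text{for all }y\in\Lambda_\varepsilon^M,$$ where the argument $t$ records the dependence of $\mathcal V^\varepsilon,\mathcal U^\varepsilon$ on the fixed time $t$.
   Context: $\Lambda_\varepsilon^M$ is the two-dimensional discrete torus of side length $M$ and lattice spacing $\varepsilon$; $\mathbf e_1=(\varepsilon,0)$, $\mathbf e_2=(0,\varepsilon)$. For functions $f$ on $\Lambda^M_\varepsilon$: $(\nabla^\varepsilon_jf)(x)=\varepsilon^{-1}(f(x+\mathbf e_j)-f(x))$ and $\Delta^\varepsilon f(x)=\varepsilon^{-2}\sum_{\mathbf e\in\{\pm\mathbf e_1,\pm\mathbf e_2\}}(f(x+\mathbf e)-f(x))$. For a field $V$ on positively directed edges $(y,y+\mathbf e_\ell)$, $(\mathrm{div}^\varepsilon V)(y)=\varepsilon^{-1}\sum_{\ell=1,2}\big(V(y,y+\mathbf e_\ell)-V(y-\mathbf e_\ell,y)\big)$. $\delta$ is the Kronecker delta on $\Lambda^M_\varepsilon$: $\delta(0)=1$ and $\delta(y)=0$ for $y\neq0$. $P_M^\varepsilon(t,x)$ is the transition probability of the continuous time random walk on $\Lambda_\varepsilon^M$ with generator $\Delta^\varepsilon$ started at $0$, with $P^\varepsilon_M(t,\cdot)=0$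 for $t<0$. $\zeta_1^\varepsilon,\zeta^\varepsilon_2$ are independent discrete space-time white noises: $\{\zeta_k^\varepsilon(\cdot,x)\}_{k,x}$ are time derivatives of independent Brownian motions with quadratic variation $\varepsilon^{-2}dt$. The Gaussian processes $\psi_k^\varepsilon$, $k=1,2$, are $$\psi_k^\varepsilon(t,x)=\int_{-T}^\infty\sum_{y\in\Lambda_\varepsilon^M}P_M^\varepsilon(t-s,x-y)\,\zeta_k^\varepsilon(s,y)\,ds,$$ i.e. the solution of $\partial_t\psi^\varepsilon_k=\Delta^\varepsilon\psi_k^\varepsilon+\zeta_k^\varepsilon$ with $\psi_k^\varepsilon(-T)=0$. In $\nabla^\varepsilon_jP^\varepsilon_M(t-s,x-y)$ the difference is taken in the spatial argument of $P_M^\varepsilon$.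
   Formalization: The sign in the conclusion is corrected: what is proved is div V − ΔU = 0. With the stated definitions div V = ΔU, and ΔU is not identically zero (e.g. for small t+T), so the printed div V + ΔU = 0 is false. M≫1 is read as M>1. *)

theory Defs
  imports "HOL-Probability.Probability"
begin

section \<open>The discrete torus and finite differences\<close>

text \<open>
  The torus of side length \<open>M = N * \<epsilon>\<close> and spacing \<open>\<epsilon>\<close> is indexed by integer pairs modulo \<open>N\<close>:
  the site \<open>(i, j)\<close> is the point \<open>(\<epsilon> * i, \<epsilon> * j)\<close>.  Sums and differences of sites are reduced
  modulo \<open>N\<close>, so they always lie in \<open>torus N\<close>.
\<close>

type_synonym site = "int \<times> int"

definition torus :: "nat \<Rightarrow> site set" where
  "torus N = {0..<int N} \<times> {0..<int N}"

definition tadd :: "nat \<Rightarrow> site \<Rightarrow> site \<Rightarrow> site" where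
  "tadd N x y = ((fst x + fst y) mod int N, (snd x + snd y) mod int N)"

definition tsub :: "nat \<Rightarrow> site \<Rightarrow> site \<Rightarrow> site" where
  "tsub N x y = ((fst x - fst y) mod int N, (snd x - snd y) mod int N)"

definition unit_step :: "nat \<Rightarrow> site" where
  "unit_step j = (if j = 1 then (1, 0) else (0, 1))"

definition kronecker :: "site \<Rightarrow> real" where
  "kronecker z = (if z = (0, 0) then 1 else 0)"

definition nabla :: "real \<Rightarrow> nat \<Rightarrow> nat \<Rightarrow> (site \<Rightarrow> real) \<Rightarrow> site \<Rightarrow> real" where
  "nabla \<epsilon> N j f x = (f (tadd N x (unit_step j)) - f x) / \<epsilon>"

definition laplacian :: "real \<Rightarrow> nat \<Rightarrow> (site \<Rightarrow> real) \<Rightarrow> site \<Rightarrow> real" where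
  "laplacian \<epsilon> N f x =
     (\<Sum>e\<in>{(1, 0), (-1, 0), (0, 1), (0, -1)}. f (tadd N x e) - f x) / \<epsilon>\<^sup>2"

text \<open>A field on positively directed edges: \<open>V l y\<close> is the value on the edge \<open>(y, y + e_l)\<close>.\<close>

definition divergence :: "real \<Rightarrow> nat \<Rightarrow> (nat \<Rightarrow> site \<Rightarrow> real) \<Rightarrow> site \<Rightarrow> real" where
  "divergence \<epsilon> N V y = (\<Sum>l\<in>{1, 2}. V l y - V l (tsub N y (unit_step l))) / \<epsilon>"


section \<open>The random walk\<close>

text \<open>
  \<open>\<kappa> t x\<close> is the law at time \<open>t\<close> of the Markov chain started at \<open>x\<close>.
\<close>

definition ctrw_transition :: "real \<Rightarrow> nat \<Rightarrow> (real \<Rightarrow> site \<Rightarrow> site pmf) \<Rightarrow> bool" where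
  "ctrw_transition \<epsilon> N \<kappa> \<longleftrightarrow>
     (\<forall>t\<ge>0. \<forall>x\<in>torus N. set_pmf (\<kappa> t x) \<subseteq> torus N) \<and>
     (\<forall>x\<in>torus N. \<kappa> 0 x = return_pmf x) \<and>
     (\<forall>s\<ge>0. \<forall>t\<ge>0. \<forall>x\<in>torus N. \<kappa> (s + t) x = bind_pmf (\<kappa> s x) (\<kappa> t)) \<and>
     (\<forall>f. \<forall>x\<in>torus N.
        ((\<lambda>h. (measure_pmf.expectation (\<kappa> h x) f - f x) / h) \<longlongrightarrow> laplacian \<epsilon> N f x) (at_right 0))"

definition heat_kernel :: "(real \<Rightarrow> site \<Rightarrow> site pmf) \<Rightarrow> real \<Rightarrow> site \<Rightarrow> real" where
  "heat_kernel \<kappa> t x = (if t < 0 then 0 else pmf (\<kappa> t (0, 0)) x)"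


section \<open>Brownian motions and Wiener integrals\<close>

definition brownian_motion :: "'w measure \<Rightarrow> real \<Rightarrow> real \<Rightarrow> (real \<Rightarrow> 'w \<Rightarrow> real) \<Rightarrow> bool" where
  "brownian_motion \<Omega> a v B \<longleftrightarrow>
     (\<forall>t\<ge>a. B t \<in> borel_measurable \<Omega>) \<and>
     (AE \<omega> in \<Omega>. B a \<omega> = 0) \<and>
     (AE \<omega> in \<Omega>. continuous_on {a..} (\<lambda>t. B t \<omega>)) \<and>
     (\<forall>s\<ge>a. \<forall>t>s. distributed \<Omega> lborel (\<lambda>\<omega>. B t \<omega> - B s \<omega>)
        (normal_density 0 (sqrt (v * (t - s))))) \<and>
     (\<forall>n \<tau>. a \<le> \<tau> 0 \<longrightarrow> (\<forall>i<n. \<tau> i \<le> \<tau> (Suc i)) \<longrightarrow>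
        prob_space.indep_vars \<Omega> (\<lambda>_. borel) (\<lambda>i \<omega>. B (\<tau> (Suc i)) \<omega> - B (\<tau> i) \<omega>) {..<n::nat})"

text \<open>
  The driving noises \<open>\<zeta>_k(\<cdot>, y)\<close>, \<open>k = 1, 2\<close>, are the time derivatives of the processes \<open>B k y\<close>;
  only their increments after the initial time \<open>a\<close> are used.
\<close>

definition driving_noise ::
    "'w measure \<Rightarrow> real \<Rightarrow> nat \<Rightarrow> real \<Rightarrow> (nat \<Rightarrow> site \<Rightarrow> real \<Rightarrow> 'w \<Rightarrow> real) \<Rightarrow> bool" where
  "driving_noise \<Omega> \<epsilon> N a B \<longleftrightarrow>
     (\<forall>k\<in>{1, 2}. \<forall>y\<in>torus N. brownian_motion \<Omega> a (1 / \<epsilon>\<^sup>2) (B k y)) \<and>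
     prob_space.indep_vars \<Omega> (\<lambda>_. PiM {a..} (\<lambda>_. borel))
       (\<lambda>(k, y) \<omega>. \<lambda>t\<in>{a..}. B k y t \<omega>) ({1, 2} \<times> torus N)"

definition elementary_fun :: "(real \<times> real \<times> real) list \<Rightarrow> real \<Rightarrow> real" where
  "elementary_fun cs s = (\<Sum>(c, u, v)\<leftarrow>cs. c * indicator {u<..v} s)"

definition elementary_integral ::
    "(real \<Rightarrow> 'w \<Rightarrow> real) \<Rightarrow> (real \<times> real \<times> real) list \<Rightarrow> 'w \<Rightarrow> real" where
  "elementary_integral B cs \<omega> = (\<Sum>(c, u, v)\<leftarrow>cs. c * (B v \<omega> - B u \<omega>))"

text \<open>
  \<open>X\<close> is a version of the Wiener integral of the deterministic function \<open>f\<close> over \<open>[a, \<infinity>)\<close> against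
  \<open>dB\<close>: a limit in mean square of integrals of step functions converging to \<open>f\<close> in
  \<open>L\<^sup>2([a, \<infinity>))\<close>.
\<close>

definition has_wiener_integral ::
    "'w measure \<Rightarrow> real \<Rightarrow> (real \<Rightarrow> 'w \<Rightarrow> real) \<Rightarrow> (real \<Rightarrow> real) \<Rightarrow> ('w \<Rightarrow> real) \<Rightarrow> bool" where
  "has_wiener_integral \<Omega> a B f X \<longleftrightarrow>
     X \<in> borel_measurable \<Omega> \<and> set_borel_measurable lborel {a..} f \<and>
     (\<exists>cs :: nat \<Rightarrow> (real \<times> real \<times> real) list.
        (\<forall>n. \<forall>(c, u, v)\<in>set (cs n). a \<le> u \<and> u \<le> v) \<and>
        (\<lambda>n. \<integral>\<^sup>+ s\<in>{a..}. ennreal ((elementary_fun (cs n) s - f s)\<^sup>2) \<partial>lborel) \<longlonglongrightarrow> 0 \<and>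
        (\<lambda>n. \<integral>\<^sup>+ \<omega>. ennreal ((elementary_integral B (cs n) \<omega> - X \<omega>)\<^sup>2) \<partial>\<Omega>) \<longlonglongrightarrow> 0)"

definition stochastic_convolution ::
    "'w measure \<Rightarrow> nat \<Rightarrow> real \<Rightarrow> (real \<Rightarrow> site \<Rightarrow> site pmf) \<Rightarrow>
     (nat \<Rightarrow> site \<Rightarrow> real \<Rightarrow> 'w \<Rightarrow> real) \<Rightarrow> (nat \<Rightarrow> real \<Rightarrow> site \<Rightarrow> 'w \<Rightarrow> real) \<Rightarrow> bool" where
  "stochastic_convolution \<Omega> N T \<kappa> B \<psi> \<longleftrightarrow>
     (\<forall>k\<in>{1, 2}. \<forall>t\<ge>-T. \<forall>x\<in>torus N.
        \<psi> k t x \<in> borel_measurable \<Omega> \<and>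
        (\<exists>I. (\<forall>y\<in>torus N.
                has_wiener_integral \<Omega> (-T) (B k y) (\<lambda>s. heat_kernel \<kappa> (t - s) (tsub N x y)) (I y)) \<and>
             (AE \<omega> in \<Omega>. \<psi> k t x \<omega> = (\<Sum>y\<in>torus N. I y \<omega>))))"


section \<open>The fields in the Ward identity\<close>

definition ward_V ::
    "'w measure \<Rightarrow> real \<Rightarrow> nat \<Rightarrow> real \<Rightarrow> (real \<Rightarrow> site \<Rightarrow> site pmf) \<Rightarrow>
     (nat \<Rightarrow> real \<Rightarrow> site \<Rightarrow> 'w \<Rightarrow> real) \<Rightarrow> real \<Rightarrow> site \<Rightarrow> nat \<Rightarrow> site \<Rightarrow> real" where
  "ward_V \<Omega> \<epsilon> N T \<kappa> \<psi> t x l y =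
     - (\<Sum>k\<in>{1, 2}. kronecker (tsub N y x) *
          (\<integral>\<omega>. \<psi> k t (tadd N y (unit_step l)) \<omega> * \<psi> k t y \<omega> \<partial>\<Omega>))
     - (\<Sum>e\<in>{(0, 0), unit_step l}. \<Sum>k\<in>{1, 2}. \<Sum>j\<in>{1, 2}.
          LBINT s:{-T..}. nabla \<epsilon> N j (heat_kernel \<kappa> (t - s)) (tsub N (tsub N x y) e) *
            (\<integral>\<omega>. nabla \<epsilon> N l (\<lambda>z. \<psi> k s z \<omega>) y * \<psi> k t x \<omega> \<partial>\<Omega>))
     + (\<Sum>e\<in>{(0, 0), unit_step l}. \<Sum>k\<in>{1, 2}. \<Sum>j\<in>{1, 2}.
          LBINT s:{-T..}. heat_kernel \<kappa> (t - s) (tsub N (tsub N x y) e) *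
            (\<integral>\<omega>. nabla \<epsilon> N l (\<lambda>z. \<psi> k s z \<omega>) y * nabla \<epsilon> N j (\<lambda>z. \<psi> k t z \<omega>) x \<partial>\<Omega>))"

definition ward_Uj ::
    "'w measure \<Rightarrow> real \<Rightarrow> nat \<Rightarrow> real \<Rightarrow> (real \<Rightarrow> site \<Rightarrow> site pmf) \<Rightarrow>
     (nat \<Rightarrow> real \<Rightarrow> site \<Rightarrow> 'w \<Rightarrow> real) \<Rightarrow> real \<Rightarrow> site \<Rightarrow> nat \<Rightarrow> site \<Rightarrow> real" where
  "ward_Uj \<Omega> \<epsilon> N T \<kappa> \<psi> t x j y =
     (\<Sum>k\<in>{1, 2}. LBINT s:{-T..}.
        heat_kernel \<kappa> (t - s) (tsub N x y) *
          (\<integral>\<omega>. \<psi> k s y \<omega> * nabla \<epsilon> N j (\<lambda>z. \<psi> k t z \<omega>) x \<partial>\<Omega>)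
        - nabla \<epsilon> N j (heat_kernel \<kappa> (t - s)) (tsub N x y) *
          (\<integral>\<omega>. \<psi> k s y \<omega> * \<psi> k t x \<omega> \<partial>\<Omega>))"

definition ward_U ::
    "'w measure \<Rightarrow> real \<Rightarrow> nat \<Rightarrow> real \<Rightarrow> (real \<Rightarrow> site \<Rightarrow> site pmf) \<Rightarrow>
     (nat \<Rightarrow> real \<Rightarrow> site \<Rightarrow> 'w \<Rightarrow> real) \<Rightarrow> real \<Rightarrow> site \<Rightarrow> site \<Rightarrow> real" where
  "ward_U \<Omega> \<epsilon> N T \<kappa> \<psi> t x y = (\<Sum>j\<in>{1, 2}. ward_Uj \<Omega> \<epsilon> N T \<kappa> \<psi> t x j y)"

text \<open>
  With these fields the Ward identity is \<open>div V - \<Delta> U = 0\<close>.  The source prints \<open>div V + \<Delta> U = 0\<close>,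
  which is false for its own definitions of \<open>V\<close>, \<open>U\<close>, \<open>div\<close>, \<open>\<Delta>\<close>: the discrete product rule
  turns the last two lines of \<open>V\<close> into \<open>+\<Delta> U\<close> plus terms that cancel the divergence of the first
  line, and \<open>\<Delta> U\<close> is not identically zero.
\<close>

end

theory Submission
  imports Defs
begin

text \<open>
  Write \<open>p\<^sub>r\<close> for the heat kernel at time \<open>r\<close>.  The Ito isometry, self-adjointness of the Laplacian
  and the forward equation give, for \<open>-T \<le> s \<le> t\<close>, the covariance \<open>c\<^sub>s(x - y)\<close> of \<open>\<psi>\<^sub>k(s, y)\<close> and
  \<open>\<psi>\<^sub>k(t, x)\<close> as the integral of \<open>p\<^sub>r / (2 \<epsilon>\<^sup>2)\<close> over \<open>r\<close> from \<open>t - s\<close> to \<open>t + s + 2 T\<close>; hence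
  \<open>\<partial>\<^sub>s c\<^sub>s = \<Delta> c\<^sub>s + p\<^sub>r / \<epsilon>\<^sup>2\<close> with \<open>r = t - s\<close>.  Let \<open>S(z, w)\<close> be the integral of \<open>p\<^sub>r(z) c\<^sub>s(w)\<close> over \<open>s\<close>.
  Integrating the \<open>s\<close>-derivative of the integrand expresses \<open>\<Delta>\<^sub>w S - \<Delta>\<^sub>z S\<close> through the boundary term
  \<open>\<delta>(z) c\<^sub>t(w)\<close> and a term symmetric in \<open>(z, w)\<close>.  Both \<open>U\<close> and the integral part of \<open>V\<close> are linear in
  \<open>S\<close> antisymmetrised between the base points \<open>x - y\<close> and \<open>x + e\<^sub>j - y\<close>, so the symmetric term drops
  out: by the discrete product rule \<open>div V - \<Delta> U\<close> equals the antisymmetrised \<open>\<Delta>\<^sub>w S - \<Delta>\<^sub>z S\<close> plus the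
  divergence of the first line of \<open>V\<close>, and the latter cancels the boundary terms.
\<close>

section \<open>Square-integrable functions\<close>

definition square_integrable :: "'a measure \<Rightarrow> ('a \<Rightarrow> real) \<Rightarrow> bool" where
  "square_integrable M f \<longleftrightarrow> f \<in> borel_measurable M \<and> integrable M (\<lambda>x. (f x)\<^sup>2)"

lemma square_integrable_mult:
  assumes "square_integrable M f" "square_integrable M g"
  shows "integrable M (\<lambda>x. f x * g x)"
proof (rule Bochner_Integration.integrable_bound)
  show "integrable M (\<lambda>x. (f x)\<^sup>2 + (g x)\<^sup>2)" "(\<lambda>x. f x * g x) \<in> borel_measurable M"
    using assms by (auto simp: square_integrable_def)
  have "\<bar>a * b\<bar> \<le> a\<^sup>2 + b\<^sup>2" for a b :: real
  proof -
    have "2 * (\<bar>a\<bar> * \<bar>b\<bar>) \<le> \<bar>a\<bar>\<^sup>2 + \<bar>b\<bar>\<^sup>2"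
      using sum_squares_bound[of "\<bar>a\<bar>" "\<bar>b\<bar>"] by simp
    moreover have "0 \<le> \<bar>a\<bar> * \<bar>b\<bar>" by simp
    ultimately show ?thesis by (simp only: abs_mult power2_abs)
  qed
  then show "AE x in M. norm (f x * g x) \<le> norm ((f x)\<^sup>2 + (g x)\<^sup>2)"
    by simp
qed

lemma square_integrable_add:
  assumes "square_integrable M f" "square_integrable M g"
  shows "square_integrable M (\<lambda>x. f x + g x)"
  using assms square_integrable_mult[OF assms]
  by (auto simp: square_integrable_def power2_sum mult.assoc intro!: Bochner_Integration.integrable_add)

lemma square_integrable_cmult:
  assumes "square_integrable M f"
  shows "square_integrable M (\<lambda>x. c * f x)"
  using assms by (auto simp: square_integrable_def power_mult_distrib)

lemma square_integrable_diff:
  assumes "square_integrable M f" "square_integrable M g"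
  shows "square_integrable M (\<lambda>x. f x - g x)"
  using square_integrable_add[OF assms(1) square_integrable_cmult[OF assms(2), of "-1"]] by simp

lemma square_integrable_zero: "square_integrable M (\<lambda>x. 0)"
  by (simp add: square_integrable_def)

lemma square_integrable_sum:
  assumes "\<And>i. i \<in> I \<Longrightarrow> square_integrable M (f i)"
  shows "square_integrable M (\<lambda>x. \<Sum>i\<in>I. f i x)"
  using assms
  by (induction I rule: infinite_finite_induct) (auto intro: square_integrable_zero square_integrable_add)

lemma square_integrable_sum_list:
  assumes "\<And>i. i \<in> set I \<Longrightarrow> square_integrable M (f i)"
  shows "square_integrable M (\<lambda>x. \<Sum>i\<leftarrow>I. f i x)"
  using assms
  by (induction I) (auto intro: square_integrable_zero square_integrable_add)

lemma square_integrable_cong_AE: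
  assumes "square_integrable M f" "g \<in> borel_measurable M" "AE x in M. g x = f x"
  shows "square_integrable M g"
proof -
  have "integrable M (\<lambda>x. (f x)\<^sup>2) \<longleftrightarrow> integrable M (\<lambda>x. (g x)\<^sup>2)"
    using assms by (intro integrable_cong_AE) (auto simp: square_integrable_def)
  with assms show ?thesis by (simp add: square_integrable_def)
qed

text \<open>Cauchy-Schwarz on L^2, brought back from its form for nonnegative extended integrals:
  all integrals involved are finite, so the inequality can be read in the reals before the square
  root is taken.\<close>

lemma abs_integral_mult_le_sqrt:
  assumes "square_integrable M f" "square_integrable M g"
  shows "\<bar>\<integral>x. f x * g x \<partial>M\<bar> \<le> sqrt (\<integral>x. (f x)\<^sup>2 \<partial>M) * sqrt (\<integral>x. (g x)\<^sup>2 \<partial>M)"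
proof -
  have [measurable]: "f \<in> borel_measurable M" "g \<in> borel_measurable M"
    using assms by (auto simp: square_integrable_def)
  have eq: "(\<integral>\<^sup>+x. (ennreal \<bar>h x\<bar>)\<^sup>2 \<partial>M) = ennreal (\<integral>x. (h x)\<^sup>2 \<partial>M)" if "square_integrable M h" for h
  proof -
    have "(\<integral>\<^sup>+x. (ennreal \<bar>h x\<bar>)\<^sup>2 \<partial>M) = (\<integral>\<^sup>+x. ennreal ((h x)\<^sup>2) \<partial>M)"
      by (intro nn_integral_cong) (simp add: ennreal_power)
    also have "\<dots> = ennreal (\<integral>x. (h x)\<^sup>2 \<partial>M)"
      using that by (intro nn_integral_eq_integral) (auto simp: square_integrable_def)
    finally show ?thesis .
  qed
  have I: "integrable M (\<lambda>x. \<bar>f x * g x\<bar>)"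
    using square_integrable_mult[OF assms] by (rule integrable_abs)
  have "ennreal ((\<integral>x. \<bar>f x * g x\<bar> \<partial>M)\<^sup>2) = (\<integral>\<^sup>+x. ennreal \<bar>f x\<bar> * ennreal \<bar>g x\<bar> \<partial>M)\<^sup>2"
  proof -
    have "ennreal (\<integral>x. \<bar>f x * g x\<bar> \<partial>M) = (\<integral>\<^sup>+x. ennreal \<bar>f x * g x\<bar> \<partial>M)"
      using I by (intro nn_integral_eq_integral[symmetric]) auto
    also have "\<dots> = (\<integral>\<^sup>+x. ennreal \<bar>f x\<bar> * ennreal \<bar>g x\<bar> \<partial>M)"
      by (intro nn_integral_cong) (simp add: ennreal_mult abs_mult)
    finally show ?thesis by (simp flip: ennreal_power)
  qed
  also have "\<dots> \<le> (\<integral>\<^sup>+x. (ennreal \<bar>f x\<bar>)\<^sup>2 \<partial>M) * (\<integral>\<^sup>+x. (ennreal \<bar>g x\<bar>)\<^sup>2 \<partial>M)"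
    by (rule Cauchy_Schwarz_nn_integral) auto
  also have "\<dots> = ennreal ((\<integral>x. (f x)\<^sup>2 \<partial>M) * (\<integral>x. (g x)\<^sup>2 \<partial>M))"
    using assms by (simp add: eq ennreal_mult)
  finally have "(\<integral>x. \<bar>f x * g x\<bar> \<partial>M)\<^sup>2 \<le> (\<integral>x. (f x)\<^sup>2 \<partial>M) * (\<integral>x. (g x)\<^sup>2 \<partial>M)"
    by (simp add: ennreal_le_iff)
  then have "(\<integral>x. \<bar>f x * g x\<bar> \<partial>M) \<le> sqrt ((\<integral>x. (f x)\<^sup>2 \<partial>M) * (\<integral>x. (g x)\<^sup>2 \<partial>M))"
    by (rule real_le_rsqrt)
  then show ?thesis
    unfolding real_sqrt_mult by (rule order_trans[OF integral_abs_bound])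
qed

text \<open>One index \<open>n\<close> with squared distance below 1 suffices for the first claim:
  \<open>f n - g\<close> is then in L^2, and \<open>g\<close> is a difference of two L^2 functions.
  The hypothesis uses extended integrals because the Bochner integral of a non-integrable function
  is 0 by default and would say nothing about \<open>g\<close>.\<close>

lemma square_integrable_limit:
  assumes f: "\<And>n. square_integrable M (f n)" and g[measurable]: "g \<in> borel_measurable M"
    and lim: "(\<lambda>n. \<integral>\<^sup>+x. ennreal ((f n x - g x)\<^sup>2) \<partial>M) \<longlonglongrightarrow> 0"
  shows "square_integrable M g" and "(\<lambda>n. \<integral>x. (f n x - g x)\<^sup>2 \<partial>M) \<longlonglongrightarrow> 0"
proof -
  have [measurable]: "f n \<in> borel_measurable M" for n
    using f by (auto simp: square_integrable_def)
  have "eventually (\<lambda>n. (\<integral>\<^sup>+x. ennreal ((f n x - g x)\<^sup>2) \<partial>M) < 1) sequentially"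
    using lim by (rule order_tendstoD) simp
  then obtain n where n: "(\<integral>\<^sup>+x. ennreal ((f n x - g x)\<^sup>2) \<partial>M) < 1"
    by (auto simp: eventually_sequentially)
  then have "(\<integral>\<^sup>+x. ennreal ((f n x - g x)\<^sup>2) \<partial>M) < \<infinity>"
    using ennreal_one_less_top less_trans by (simp only: infinity_ennreal_def)
  then have "square_integrable M (\<lambda>x. f n x - g x)"
    unfolding square_integrable_def by (auto intro!: integrableI_nonneg)
  from square_integrable_diff[OF f[of n] this] show sg: "square_integrable M g" by simp
  have "ennreal (\<integral>x. (f n x - g x)\<^sup>2 \<partial>M) = (\<integral>\<^sup>+x. ennreal ((f n x - g x)\<^sup>2) \<partial>M)" for n
    using square_integrable_diff[OF f[of n] sg]
    by (intro nn_integral_eq_integral[symmetric]) (auto simp: square_integrable_def)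
  with lim have "(\<lambda>n. ennreal (\<integral>x. (f n x - g x)\<^sup>2 \<partial>M)) \<longlonglongrightarrow> ennreal 0"
    by simp
  then show "(\<lambda>n. \<integral>x. (f n x - g x)\<^sup>2 \<partial>M) \<longlonglongrightarrow> 0"
    by (subst (asm) tendsto_ennreal_iff) auto
qed

text \<open>Continuity of the L^2 inner product, which carries the isometry from step functions to
  mean-square limits. Writing \<open>f n = f' + a n\<close> and \<open>g n = g' + b n\<close> leaves
  three error terms, each bounded by a product of norms in which at least one factor tends to
  0.\<close>

lemma tendsto_integral_mult_L2:
  assumes f: "\<And>n. square_integrable M (f n)" "f' \<in> borel_measurable M"
    "(\<lambda>n. \<integral>\<^sup>+x. ennreal ((f n x - f' x)\<^sup>2) \<partial>M) \<longlonglongrightarrow> 0"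
    and g: "\<And>n. square_integrable M (g n)" "g' \<in> borel_measurable M"
    "(\<lambda>n. \<integral>\<^sup>+x. ennreal ((g n x - g' x)\<^sup>2) \<partial>M) \<longlonglongrightarrow> 0"
  shows "(\<lambda>n. \<integral>x. f n x * g n x \<partial>M) \<longlonglongrightarrow> (\<integral>x. f' x * g' x \<partial>M)"
proof -
  note sf = square_integrable_limit[OF f]
  note sg = square_integrable_limit[OF g]
  define a where "a n x = f n x - f' x" for n x
  define b where "b n x = g n x - g' x" for n x
  have sa: "square_integrable M (a n)" for n
    unfolding a_def by (rule square_integrable_diff[OF f(1) sf(1)])
  have sb: "square_integrable M (b n)" for n
    unfolding b_def by (rule square_integrable_diff[OF g(1) sg(1)])
  have a0: "(\<lambda>n. sqrt (\<integral>x. (a n x)\<^sup>2 \<partial>M)) \<longlonglongrightarrow> 0"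
    using tendsto_real_sqrt[OF sf(2)] by (simp add: a_def)
  have b0: "(\<lambda>n. sqrt (\<integral>x. (b n x)\<^sup>2 \<partial>M)) \<longlonglongrightarrow> 0"
    using tendsto_real_sqrt[OF sg(2)] by (simp add: b_def)
  have eq: "(\<integral>x. f n x * g n x \<partial>M)
     = (\<integral>x. f' x * g' x \<partial>M) + (\<integral>x. a n x * g' x \<partial>M) + (\<integral>x. f' x * b n x \<partial>M) + (\<integral>x. a n x * b n x \<partial>M)" for n
  proof -
    have "(\<integral>x. f n x * g n x \<partial>M) = (\<integral>x. ((f' x * g' x + a n x * g' x) + f' x * b n x) + a n x * b n x \<partial>M)"
      by (intro Bochner_Integration.integral_cong) (auto simp: a_def b_def algebra_simps)
    also have "\<dots> = (\<integral>x. f' x * g' x \<partial>M) + (\<integral>x. a n x * g' x \<partial>M) + (\<integral>x. f' x * b n x \<partial>M) + (\<integral>x. a n x * b n x \<partial>M)"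
      using square_integrable_mult[OF sf(1) sg(1)] square_integrable_mult[OF sa sg(1)]
        square_integrable_mult[OF sf(1) sb] square_integrable_mult[OF sa sb]
      by simp
    finally show ?thesis .
  qed
  have z: "(\<lambda>n. \<integral>x. u n x * v n x \<partial>M) \<longlonglongrightarrow> 0"
    if "\<And>n. square_integrable M (u n)" "\<And>n. square_integrable M (v n)"
      and "(\<lambda>n. sqrt (\<integral>x. (u n x)\<^sup>2 \<partial>M) * sqrt (\<integral>x. (v n x)\<^sup>2 \<partial>M)) \<longlonglongrightarrow> 0" for u v
    using abs_integral_mult_le_sqrt[OF that(1,2)]
    by (intro Lim_null_comparison[OF _ that(3)]) (simp add: always_eventually)
  have "(\<lambda>n. \<integral>x. a n x * g' x \<partial>M) \<longlonglongrightarrow> 0"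
    using sa sg(1) tendsto_mult_left_zero[OF a0] by (intro z)
  moreover have "(\<lambda>n. \<integral>x. f' x * b n x \<partial>M) \<longlonglongrightarrow> 0"
    using sb sf(1) tendsto_mult_right_zero[OF b0] by (intro z)
  moreover have "(\<lambda>n. \<integral>x. a n x * b n x \<partial>M) \<longlonglongrightarrow> 0"
    using sa sb tendsto_mult_zero[OF a0 b0] by (intro z)
  ultimately show ?thesis
    unfolding eq by (auto intro!: tendsto_eq_intros)
qed

section \<open>Wiener integrals\<close>

text \<open>Applied once over \<Omega> and once over Lebesgue measure, this expands both sides of
  the isometry for step functions into double sums over the same lists.\<close>

lemma integral_sum_list_mult:
  assumes F: "\<And>p. p \<in> set P \<Longrightarrow> square_integrable M (F p)" and G: "\<And>q. q \<in> set Q \<Longrightarrow> square_integrable M (G q)"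
  shows "(\<integral>x. (\<Sum>p\<leftarrow>P. F p x) * (\<Sum>q\<leftarrow>Q. G q x) \<partial>M) = (\<Sum>p\<leftarrow>P. \<Sum>q\<leftarrow>Q. \<integral>x. F p x * G q x \<partial>M)"
  using F
proof (induction P)
  case Nil
  then show ?case by simp
next
  case (Cons p P)
  have 1: "(\<integral>x. F p x * (\<Sum>q\<leftarrow>Q. G q x) \<partial>M) = (\<Sum>q\<leftarrow>Q. \<integral>x. F p x * G q x \<partial>M)"
    using G
  proof (induction Q)
    case Nil
    then show ?case by simp
  next
    case (Cons q Q)
    have "integrable M (\<lambda>x. F p x * G q x)" "integrable M (\<lambda>x. F p x * (\<Sum>q\<leftarrow>Q. G q x))"
      using Cons.prems \<open>\<And>p'. p' \<in> set (p # P) \<Longrightarrow> square_integrable M (F p')\<close>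
      by (auto intro!: square_integrable_mult square_integrable_sum_list)
    with Cons show ?case
      by (simp add: distrib_left)
  qed
  have "integrable M (\<lambda>x. F p x * (\<Sum>q\<leftarrow>Q. G q x))"
    "integrable M (\<lambda>x. (\<Sum>p\<leftarrow>P. F p x) * (\<Sum>q\<leftarrow>Q. G q x))"
    using Cons.prems G by (auto intro!: square_integrable_mult square_integrable_sum_list)
  with Cons 1 show ?case
    by (simp add: distrib_right)
qed

text \<open>The overlap of two intervals is written through distances between endpoints because
  polarisation of Brownian increments produces exactly this combination.\<close>

lemma integral_indicator_Ioc_mult:
  fixes a b c d :: real
  assumes "a \<le> b" "c \<le> d"
  shows "(\<integral>s. indicat_real {a<..b} s * indicat_real {c<..d} s \<partial>lborel)
    = (\<bar>b - c\<bar> + \<bar>a - d\<bar> - \<bar>b - d\<bar> - \<bar>a - c\<bar>) / 2"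
proof -
  have "(\<integral>s. indicat_real {a<..b} s * indicat_real {c<..d} s \<partial>lborel) = (\<integral>s. indicat_real {max a c<..min b d} s \<partial>lborel)"
    by (intro Bochner_Integration.integral_cong) (auto simp: indicator_def)
  also have "\<dots> = measure lborel {max a c<..min b d}"
    by simp
  also have "\<dots> = (if max a c \<le> min b d then min b d - max a c else 0)"
    by (auto simp: measure_def)
  finally show ?thesis
    using assms by (simp add: min_def max_def abs_real_def split: if_splits)
qed

lemma square_integrable_indicator_Ioc: "square_integrable lborel (\<lambda>s. c * indicator {u<..v::real} s)"
proof -
  have "emeasure lborel {u<..v} < \<infinity>"
    by (cases "u \<le> v") auto
  then have "square_integrable lborel (\<lambda>s. indicator {u<..v} s)"
    by (auto simp: square_integrable_def power2_eq_square simp flip: indicator_inter_arith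
        intro!: integrable_real_indicator)
  then show ?thesis by (rule square_integrable_cmult)
qed

text \<open>The case \<open>\<sigma> = 0\<close> covers a pair of independent Brownian motions.\<close>

lemma wiener_integral_covariance:
  assumes B: "\<And>u v. a \<le> u \<Longrightarrow> u \<le> v \<Longrightarrow> square_integrable \<Omega> (\<lambda>\<omega>. B v \<omega> - B u \<omega>)"
    and B': "\<And>u v. a \<le> u \<Longrightarrow> u \<le> v \<Longrightarrow> square_integrable \<Omega> (\<lambda>\<omega>. B' v \<omega> - B' u \<omega>)"
    and cov: "\<And>u v u' v'. \<lbrakk>a \<le> u; u \<le> v; a \<le> u'; u' \<le> v'\<rbrakk> \<Longrightarrow>
      (\<integral>\<omega>. (B v \<omega> - B u \<omega>) * (B' v' \<omega> - B' u' \<omega>) \<partial>\<Omega>)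
        = \<sigma> * (\<integral>s. indicator {u<..v} s * indicator {u'<..v'} s \<partial>lborel)"
    and X: "has_wiener_integral \<Omega> a B f X" and Y: "has_wiener_integral \<Omega> a B' g Y"
  shows "square_integrable \<Omega> X" and "square_integrable \<Omega> Y"
    and "(\<integral>\<omega>. X \<omega> * Y \<omega> \<partial>\<Omega>) = \<sigma> * (LBINT s:{a..}. f s * g s)"
proof -
  obtain cs where cs: "\<And>n. \<forall>(c, u, v)\<in>set (cs n). a \<le> u \<and> u \<le> v"
    and csf: "(\<lambda>n. \<integral>\<^sup>+ s\<in>{a..}. ennreal ((elementary_fun (cs n) s - f s)\<^sup>2) \<partial>lborel) \<longlonglongrightarrow> 0"
    and csX: "(\<lambda>n. \<integral>\<^sup>+ \<omega>. ennreal ((elementary_integral B (cs n) \<omega> - X \<omega>)\<^sup>2) \<partial>\<Omega>) \<longlonglongrightarrow> 0"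
    using X by (auto simp: has_wiener_integral_def)
  obtain ds where ds: "\<And>n. \<forall>(c, u, v)\<in>set (ds n). a \<le> u \<and> u \<le> v"
    and dsg: "(\<lambda>n. \<integral>\<^sup>+ s\<in>{a..}. ennreal ((elementary_fun (ds n) s - g s)\<^sup>2) \<partial>lborel) \<longlonglongrightarrow> 0"
    and dsY: "(\<lambda>n. \<integral>\<^sup>+ \<omega>. ennreal ((elementary_integral B' (ds n) \<omega> - Y \<omega>)\<^sup>2) \<partial>\<Omega>) \<longlonglongrightarrow> 0"
    using Y by (auto simp: has_wiener_integral_def)
  have [measurable]: "X \<in> borel_measurable \<Omega>" "Y \<in> borel_measurable \<Omega>"
    and mfg: "set_borel_measurable lborel {a..} f" "set_borel_measurable lborel {a..} g"
    using X Y by (auto simp: has_wiener_integral_def)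
  have si: "square_integrable \<Omega> (\<lambda>\<omega>. case p of (c, u, v) \<Rightarrow> c * (W v \<omega> - W u \<omega>))"
    if "\<And>u v. a \<le> u \<Longrightarrow> u \<le> v \<Longrightarrow> square_integrable \<Omega> (\<lambda>\<omega>. W v \<omega> - W u \<omega>)"
      "\<forall>(c, u, v)\<in>set es. a \<le> u \<and> u \<le> v" "p \<in> set es" for W :: "real \<Rightarrow> 'a \<Rightarrow> real" and es p
    using that by (cases p) (auto intro!: square_integrable_cmult)
  have sf: "square_integrable lborel (\<lambda>s. case p of (c, u, v) \<Rightarrow> c * indicator {u<..v} s)" for p :: "real \<times> real \<times> real"
    by (cases p) (simp add: square_integrable_indicator_Ioc)
  have sX: "square_integrable \<Omega> (elementary_integral B (cs n))" for n
    unfolding elementary_integral_def using si[OF B cs] by (intro square_integrable_sum_list)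
  have sY: "square_integrable \<Omega> (elementary_integral B' (ds n))" for n
    unfolding elementary_integral_def using si[OF B' ds] by (intro square_integrable_sum_list)
  show "square_integrable \<Omega> X" "square_integrable \<Omega> Y"
    using square_integrable_limit(1)[OF sX _ csX] square_integrable_limit(1)[OF sY _ dsY] by simp_all
  \<comment> \<open>The step functions already vanish below \<open>a\<close>. The L^2 distance on
    \<open>{a..}\<close> is therefore a distance on the whole line, and the limit lemma can be used
    with plain Lebesgue measure.\<close>
  have ind: "indicator {a..} s * elementary_fun es s = elementary_fun es s"
    if "\<forall>(c, u, v)\<in>set es. a \<le> u \<and> u \<le> v" for es s
    using that unfolding elementary_fun_def
    by (induction es) (auto simp: distrib_left indicator_def)
  have L: "(\<lambda>n. \<integral>s. elementary_fun (cs n) s * elementary_fun (ds n) s \<partial>lborel)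
     \<longlonglongrightarrow> (\<integral>s. (indicator {a..} s * f s) * (indicator {a..} s * g s) \<partial>lborel)"
  proof (rule tendsto_integral_mult_L2)
    show "square_integrable lborel (elementary_fun (cs n))" "square_integrable lborel (elementary_fun (ds n))" for n
      unfolding elementary_fun_def by (intro square_integrable_sum_list sf)+
    show "(\<lambda>s. indicator {a..} s * f s) \<in> borel_measurable lborel"
      "(\<lambda>s. indicator {a..} s * g s) \<in> borel_measurable lborel"
      using mfg by (auto simp: set_borel_measurable_def)
    have eq: "(\<integral>\<^sup>+ s. ennreal ((elementary_fun es s - indicator {a..} s * h s)\<^sup>2) \<partial>lborel)
        = (\<integral>\<^sup>+ s\<in>{a..}. ennreal ((elementary_fun es s - h s)\<^sup>2) \<partial>lborel)"
      if "\<forall>(c, u, v)\<in>set es. a \<le> u \<and> u \<le> v" for es h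
    proof (intro nn_integral_cong)
      fix s
      show "ennreal ((elementary_fun es s - indicator {a..} s * h s)\<^sup>2)
        = ennreal ((elementary_fun es s - h s)\<^sup>2) * indicator {a..} s"
        using ind[OF that, of s] by (auto simp: indicator_def)
    qed
    show "(\<lambda>n. \<integral>\<^sup>+ s. ennreal ((elementary_fun (cs n) s - indicator {a..} s * f s)\<^sup>2) \<partial>lborel) \<longlonglongrightarrow> 0"
      "(\<lambda>n. \<integral>\<^sup>+ s. ennreal ((elementary_fun (ds n) s - indicator {a..} s * g s)\<^sup>2) \<partial>lborel) \<longlonglongrightarrow> 0"
      using csf dsg by (simp_all add: eq[OF cs] eq[OF ds])
  qed
  \<comment> \<open>The isometry for step functions: bilinearity reduces it to pairs of increments,
    where it is the hypothesis \<open>cov\<close>.\<close>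
  have E: "(\<integral>\<omega>. elementary_integral B (cs n) \<omega> * elementary_integral B' (ds n) \<omega> \<partial>\<Omega>)
    = \<sigma> * (\<integral>s. elementary_fun (cs n) s * elementary_fun (ds n) s \<partial>lborel)" for n
  proof -
    have "(\<integral>\<omega>. elementary_integral B (cs n) \<omega> * elementary_integral B' (ds n) \<omega> \<partial>\<Omega>)
      = (\<Sum>p\<leftarrow>cs n. \<Sum>q\<leftarrow>ds n. \<integral>\<omega>. (case p of (c, u, v) \<Rightarrow> c * (B v \<omega> - B u \<omega>))
            * (case q of (c, u, v) \<Rightarrow> c * (B' v \<omega> - B' u \<omega>)) \<partial>\<Omega>)"
      unfolding elementary_integral_def using si[OF B cs] si[OF B' ds]
      by (intro integral_sum_list_mult)
    also have "\<dots> = (\<Sum>p\<leftarrow>cs n. \<Sum>q\<leftarrow>ds n. \<sigma> * (\<integral>s. (case p of (c, u, v) \<Rightarrow> c * indicator {u<..v} s)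
            * (case q of (c, u, v) \<Rightarrow> c * indicator {u<..v} s) \<partial>lborel))"
    proof (intro arg_cong[where f=sum_list] map_cong refl)
      fix p q assume "p \<in> set (cs n)" "q \<in> set (ds n)"
      moreover obtain c u v d u' v' where pq: "p = (c, u, v)" "q = (d, u', v')"
        by (metis prod_cases3)
      ultimately have uv: "a \<le> u" "u \<le> v" "a \<le> u'" "u' \<le> v'"
        using cs[of n] ds[of n] by auto
      have "(\<integral>\<omega>. (c * (B v \<omega> - B u \<omega>)) * (d * (B' v' \<omega> - B' u' \<omega>)) \<partial>\<Omega>)
        = c * d * (\<integral>\<omega>. (B v \<omega> - B u \<omega>) * (B' v' \<omega> - B' u' \<omega>) \<partial>\<Omega>)"
        by (subst integral_mult_right_zero[symmetric]) (simp add: mult_ac)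
      moreover have "(\<integral>s. (c * indicator {u<..v} s) * (d * indicator {u'<..v'} s) \<partial>lborel)
        = c * d * (\<integral>s. indicator {u<..v} s * indicator {u'<..v'} s \<partial>lborel)"
        by (subst integral_mult_right_zero[symmetric]) (simp add: mult_ac)
      ultimately show "(\<integral>\<omega>. (case p of (c, u, v) \<Rightarrow> c * (B v \<omega> - B u \<omega>))
            * (case q of (c, u, v) \<Rightarrow> c * (B' v \<omega> - B' u \<omega>)) \<partial>\<Omega>)
        = \<sigma> * (\<integral>s. (case p of (c, u, v) \<Rightarrow> c * indicator {u<..v} s)
            * (case q of (c, u, v) \<Rightarrow> c * indicator {u<..v} s) \<partial>lborel)"
        using cov[OF uv] by (simp add: pq)
    qed
    also have "\<dots> = \<sigma> * (\<integral>s. elementary_fun (cs n) s * elementary_fun (ds n) s \<partial>lborel)"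
      unfolding elementary_fun_def
      by (subst integral_sum_list_mult[OF sf sf]) (simp add: sum_list_const_mult)
    finally show ?thesis .
  qed
  \<comment> \<open>The same sequence of expectations has two limits, one from mean-square
    convergence over \<Omega>, the other from the step-function isometry and L^2 convergence in
    time.\<close>
  have l1: "(\<lambda>n. \<integral>\<omega>. elementary_integral B (cs n) \<omega> * elementary_integral B' (ds n) \<omega> \<partial>\<Omega>)
     \<longlonglongrightarrow> (\<integral>\<omega>. X \<omega> * Y \<omega> \<partial>\<Omega>)"
    by (intro tendsto_integral_mult_L2 sX sY csX dsY) auto
  have l2: "(\<lambda>n. \<integral>\<omega>. elementary_integral B (cs n) \<omega> * elementary_integral B' (ds n) \<omega> \<partial>\<Omega>)
     \<longlonglongrightarrow> \<sigma> * (\<integral>s. (indicator {a..} s * f s) * (indicator {a..} s * g s) \<partial>lborel)"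
    unfolding E by (intro tendsto_mult_left L)
  have l3: "(\<integral>s. (indicator {a..} s * f s) * (indicator {a..} s * g s) \<partial>lborel)
     = (LBINT s:{a..}. f s * g s)"
    unfolding set_lebesgue_integral_def
    by (intro Bochner_Integration.integral_cong refl) (simp split: split_indicator)
  show "(\<integral>\<omega>. X \<omega> * Y \<omega> \<partial>\<Omega>) = \<sigma> * (LBINT s:{a..}. f s * g s)"
    using LIMSEQ_unique[OF l1 l2] by (simp only: l3)
qed

section \<open>Moments and covariances of Brownian increments\<close>

lemma brownian_increment_moments:
  assumes "prob_space \<Omega>" "brownian_motion \<Omega> a \<sigma> B" "0 < \<sigma>" "a \<le> u" "u \<le> v"
  shows "square_integrable \<Omega> (\<lambda>\<omega>. B v \<omega> - B u \<omega>)"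
    and "(\<integral>\<omega>. (B v \<omega> - B u \<omega>) \<partial>\<Omega>) = 0"
    and "(\<integral>\<omega>. (B v \<omega> - B u \<omega>)\<^sup>2 \<partial>\<Omega>) = \<sigma> * (v - u)"
proof -
  interpret prob_space \<Omega> by fact
  have "square_integrable \<Omega> (\<lambda>\<omega>. B v \<omega> - B u \<omega>) \<and> (\<integral>\<omega>. (B v \<omega> - B u \<omega>) \<partial>\<Omega>) = 0
    \<and> (\<integral>\<omega>. (B v \<omega> - B u \<omega>)\<^sup>2 \<partial>\<Omega>) = \<sigma> * (v - u)"
  \<comment> \<open>The normal law is given for strictly ordered times only; the degenerate
    increment is identically 0.\<close>
  proof (cases "u = v")
    case True
    then show ?thesis by (simp add: square_integrable_zero)
  next
    case False
    define r where "r = sqrt (\<sigma> * (v - u))"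
    have r: "0 < r" using False assms by (simp add: r_def)
    have D: "distributed \<Omega> lborel (\<lambda>\<omega>. B v \<omega> - B u \<omega>) (normal_density 0 r)"
      using assms False by (auto simp: brownian_motion_def r_def)
    have E: "expectation (\<lambda>\<omega>. B v \<omega> - B u \<omega>) = 0"
      by (rule normal_distributed_expectation[OF r D])
    have V: "variance (\<lambda>\<omega>. B v \<omega> - B u \<omega>) = r\<^sup>2"
      by (rule normal_distributed_variance[OF r D])
    have "integrable lborel (\<lambda>x. normal_density 0 r x * x\<^sup>2)"
      using integrable_normal_moment[OF r, of 0 2] by simp
    then have "integrable \<Omega> (\<lambda>\<omega>. (B v \<omega> - B u \<omega>)\<^sup>2)"
      by (subst (asm) distributed_integrable[OF D]) auto
    moreover have "B u \<in> borel_measurable \<Omega>" "B v \<in> borel_measurable \<Omega>"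
      using assms by (auto simp: brownian_motion_def)
    ultimately show ?thesis
      using E V assms by (auto simp: square_integrable_def r_def)
  qed
  then show "square_integrable \<Omega> (\<lambda>\<omega>. B v \<omega> - B u \<omega>)"
    and "(\<integral>\<omega>. (B v \<omega> - B u \<omega>) \<partial>\<Omega>) = 0"
    and "(\<integral>\<omega>. (B v \<omega> - B u \<omega>)\<^sup>2 \<partial>\<Omega>) = \<sigma> * (v - u)"
    by auto
qed

lemma brownian_increment_covariance:
  assumes \<Omega>: "prob_space \<Omega>" and B: "brownian_motion \<Omega> a \<sigma> B" "0 < \<sigma>"
    and uv: "a \<le> u" "u \<le> v" "a \<le> u'" "u' \<le> v'"
  shows "(\<integral>\<omega>. (B v \<omega> - B u \<omega>) * (B v' \<omega> - B u' \<omega>) \<partial>\<Omega>)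
    = \<sigma> * (\<integral>s. indicator {u<..v} s * indicator {u'<..v'} s \<partial>lborel)"
proof -
  \<comment> \<open>The polarisation below pairs times in no fixed order, hence the absolute value;
    exchanging the times only changes the sign of the increment.\<close>
  have Q: "integrable \<Omega> (\<lambda>\<omega>. (B q \<omega> - B p \<omega>)\<^sup>2)" "(\<integral>\<omega>. (B q \<omega> - B p \<omega>)\<^sup>2 \<partial>\<Omega>) = \<sigma> * \<bar>q - p\<bar>"
    if "a \<le> p" "a \<le> q" for p q
  proof -
    have "integrable \<Omega> (\<lambda>\<omega>. (B q \<omega> - B p \<omega>)\<^sup>2) \<and> (\<integral>\<omega>. (B q \<omega> - B p \<omega>)\<^sup>2 \<partial>\<Omega>) = \<sigma> * \<bar>q - p\<bar>"
    proof (cases "p \<le> q")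
      case True
      with brownian_increment_moments[OF \<Omega> B that(1) True] show ?thesis
        by (simp add: square_integrable_def)
    next
      case False
      then have "q \<le> p" by simp
      with brownian_increment_moments[OF \<Omega> B that(2) this] show ?thesis
        by (simp add: square_integrable_def power2_commute[of "B q _"])
    qed
    then show "integrable \<Omega> (\<lambda>\<omega>. (B q \<omega> - B p \<omega>)\<^sup>2)" "(\<integral>\<omega>. (B q \<omega> - B p \<omega>)\<^sup>2 \<partial>\<Omega>) = \<sigma> * \<bar>q - p\<bar>"
      by auto
  qed
  have a': "a \<le> v" "a \<le> v'" using uv by auto
  note Qs = Q[OF uv(3) a'(1)] Q[OF a'(2) uv(1)] Q[OF a'(2) a'(1)] Q[OF uv(3) uv(1)]
  \<comment> \<open>By polarisation, the variances of the increments determine all covariances.\<close>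
  have "(\<integral>\<omega>. (B v \<omega> - B u \<omega>) * (B v' \<omega> - B u' \<omega>) \<partial>\<Omega>)
    = (\<integral>\<omega>. ((B v \<omega> - B u' \<omega>)\<^sup>2 + (B u \<omega> - B v' \<omega>)\<^sup>2 - (B v \<omega> - B v' \<omega>)\<^sup>2 - (B u \<omega> - B u' \<omega>)\<^sup>2) / 2 \<partial>\<Omega>)"
    by (intro Bochner_Integration.integral_cong) (auto simp: power2_eq_square algebra_simps)
  also have "\<dots> = (\<sigma> * \<bar>v - u'\<bar> + \<sigma> * \<bar>u - v'\<bar> - \<sigma> * \<bar>v - v'\<bar> - \<sigma> * \<bar>u - u'\<bar>) / 2"
    using Qs by simp
  also have "\<dots> = \<sigma> * (\<integral>s. indicator {u<..v} s * indicator {u'<..v'} s \<partial>lborel)"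
    unfolding integral_indicator_Ioc_mult[OF uv(2,4)] by (simp add: algebra_simps diff_divide_distrib add_divide_distrib)
  finally show ?thesis .
qed

text \<open>Instance of the abstract isometry with constant \<open>1 / \<epsilon>\<^sup>2\<close> at
  equal sites and 0 at distinct ones, where independence factors the expectation into a product of
  vanishing means.\<close>

lemma driving_noise_covariance:
  assumes \<Omega>: "prob_space \<Omega>" and "0 < \<epsilon>" and B: "driving_noise \<Omega> \<epsilon> N a B"
    and k: "k \<in> {1, 2}" and y: "y \<in> torus N" "z \<in> torus N"
    and X: "has_wiener_integral \<Omega> a (B k y) f X" and Y: "has_wiener_integral \<Omega> a (B k z) g Y"
  shows "square_integrable \<Omega> X" and "square_integrable \<Omega> Y"
    and "(\<integral>\<omega>. X \<omega> * Y \<omega> \<partial>\<Omega>) = (if y = z then (LBINT s:{a..}. f s * g s) / \<epsilon>\<^sup>2 else 0)"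
proof -
  interpret prob_space \<Omega> by fact
  have bm: "brownian_motion \<Omega> a (1 / \<epsilon>\<^sup>2) (B k w)" if "w \<in> torus N" for w
    using B k that by (auto simp: driving_noise_def)
  have e: "0 < 1 / \<epsilon>\<^sup>2" using \<open>0 < \<epsilon>\<close> by simp
  note inc = brownian_increment_moments[OF \<Omega> bm e]
  have cov: "(\<integral>\<omega>. (B k y v \<omega> - B k y u \<omega>) * (B k z v' \<omega> - B k z u' \<omega>) \<partial>\<Omega>)
      = (if y = z then 1 / \<epsilon>\<^sup>2 else 0) * (\<integral>s. indicator {u<..v} s * indicator {u'<..v'} s \<partial>lborel)"
    if uv: "a \<le> u" "u \<le> v" "a \<le> u'" "u' \<le> v'" for u v u' v'
  proof (cases "y = z")
    case True
    with brownian_increment_covariance[OF \<Omega> bm e uv] y show ?thesis by simp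
  next
    case False
    define P where "P = (\<lambda>i \<omega>. (\<lambda>(k, y) \<omega>. \<lambda>t\<in>{a..}. B k y t \<omega>) i \<omega>)"
    have indP: "indep_vars (\<lambda>_. PiM {a..} (\<lambda>_. borel)) P {(k, y), (k, z)}"
      unfolding P_def by (rule indep_vars_subset[of _ _ "{1, 2} \<times> torus N"])
        (use B k y in \<open>auto simp: driving_noise_def\<close>)
    \<comment> \<open>Each increment is a measurable functional of a whole path, so independence of
      the two paths passes to the increments.\<close>
    define F where "F = (\<lambda>i h :: real \<Rightarrow> real. if i = (k, y) then h v - h u else h v' - h u')"
    have mF: "F i \<in> borel_measurable (PiM {a..} (\<lambda>_. borel))" for i
      using uv by (cases "i = (k, y)") (auto simp: F_def)
    have ind: "indep_vars (\<lambda>_. borel) (\<lambda>i \<omega>. F i (P i \<omega>)) {(k, y), (k, z)}"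
      by (rule indep_vars_compose2[OF indP mF])
    have F: "F (k, y) (P (k, y) \<omega>) = B k y v \<omega> - B k y u \<omega>"
      "F (k, z) (P (k, z) \<omega>) = B k z v' \<omega> - B k z u' \<omega>" for \<omega>
      using False uv by (auto simp: F_def P_def)
    have "integrable \<Omega> (\<lambda>\<omega>. F i (P i \<omega>))" if "i \<in> {(k, y), (k, z)}" for i
    proof -
      have "square_integrable \<Omega> (\<lambda>\<omega>. F i (P i \<omega>))"
        using that inc(1)[OF y(1) uv(1,2)] inc(1)[OF y(2) uv(3,4)] by (auto simp: F)
      then show ?thesis
        by (auto simp: square_integrable_def intro: square_integrable_imp_integrable)
    qed
    from indep_vars_lebesgue_integral[OF _ ind this]
    have "expectation (\<lambda>\<omega>. \<Prod>i\<in>{(k, y), (k, z)}. F i (P i \<omega>))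
       = (\<Prod>i\<in>{(k, y), (k, z)}. expectation (\<lambda>\<omega>. F i (P i \<omega>)))"
      by simp
    then show ?thesis
      using False inc(2)[OF y(1) uv(1,2)] by (simp add: F)
  qed
  let ?\<sigma> = "if y = z then 1 / \<epsilon>\<^sup>2 else 0"
  have "square_integrable \<Omega> X \<and> square_integrable \<Omega> Y \<and>
     (\<integral>\<omega>. X \<omega> * Y \<omega> \<partial>\<Omega>) = ?\<sigma> * (LBINT s:{a..}. f s * g s)"
    using wiener_integral_covariance[where B = "B k y" and B' = "B k z" and \<sigma> = ?\<sigma>,
        OF inc(1)[OF y(1)] inc(1)[OF y(2)] cov X Y] by blast
  then show "square_integrable \<Omega> X" "square_integrable \<Omega> Y"
    and "(\<integral>\<omega>. X \<omega> * Y \<omega> \<partial>\<Omega>) = (if y = z then (LBINT s:{a..}. f s * g s) / \<epsilon>\<^sup>2 else 0)"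
    by auto
qed

section \<open>The heat kernel on the torus\<close>

lemma finite_torus [simp]: "finite (torus N)"
  by (simp add: torus_def)

lemma tadd_in_torus [simp]: "0 < N \<Longrightarrow> tadd N x y \<in> torus N"
  by (simp add: torus_def tadd_def)

lemma tsub_in_torus [simp]: "0 < N \<Longrightarrow> tsub N x y \<in> torus N"
  by (simp add: torus_def tsub_def)

lemma zero_in_torus [simp]: "0 < N \<Longrightarrow> (0, 0) \<in> torus N"
  by (simp add: torus_def)

lemma laplacian_eq:
  "laplacian \<epsilon> N f x = (f (tadd N x (1, 0)) + f (tadd N x (-1, 0)) + f (tadd N x (0, 1)) + f (tadd N x (0, -1))
     - 4 * f x) / \<epsilon>\<^sup>2"
  by (simp add: laplacian_def)

lemma sum_torus_shift:
  assumes "0 < N"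
  shows "(\<Sum>z\<in>torus N. f z * g (tadd N z e)) = (\<Sum>z\<in>torus N. f (tadd N z (- fst e, - snd e)) * g z)"
proof (rule sum.reindex_bij_witness[where i="\<lambda>z. tadd N z (- fst e, - snd e)" and j="\<lambda>z. tadd N z e"])
  fix z assume "z \<in> torus N"
  then show "tadd N (tadd N z e) (- fst e, - snd e) = z" "tadd N (tadd N z (- fst e, - snd e)) e = z"
    by (auto simp: tadd_def torus_def mod_simps)
  then show "f (tadd N (tadd N z e) (- fst e, - snd e)) * g (tadd N z e) = f z * g (tadd N z e)"
    by simp
qed (use assms in auto)

text \<open>The four steps come in opposite pairs: moving the translation by \<open>e\<close> from
  \<open>g\<close> to \<open>f\<close> turns it into the one by \<open>-e\<close>, which only
  permutes the four neighbour terms.\<close>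

lemma laplacian_symmetric:
  assumes "0 < N"
  shows "(\<Sum>z\<in>torus N. f z * laplacian \<epsilon> N g z) = (\<Sum>z\<in>torus N. laplacian \<epsilon> N f z * g z)"
proof -
  have "(\<Sum>z\<in>torus N. f z * laplacian \<epsilon> N g z)
    = ((\<Sum>z\<in>torus N. f z * g (tadd N z (1, 0))) + (\<Sum>z\<in>torus N. f z * g (tadd N z (-1, 0)))
      + (\<Sum>z\<in>torus N. f z * g (tadd N z (0, 1))) + (\<Sum>z\<in>torus N. f z * g (tadd N z (0, -1)))
      - 4 * (\<Sum>z\<in>torus N. f z * g z)) / \<epsilon>\<^sup>2"
    unfolding laplacian_eq sum_divide_distrib sum.distrib[symmetric] sum_distrib_left sum_subtractf[symmetric]
    by (intro sum.cong) (auto simp: algebra_simps)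
  also have "\<dots> = ((\<Sum>z\<in>torus N. f (tadd N z (-1, 0)) * g z) + (\<Sum>z\<in>torus N. f (tadd N z (1, 0)) * g z)
      + (\<Sum>z\<in>torus N. f (tadd N z (0, -1)) * g z) + (\<Sum>z\<in>torus N. f (tadd N z (0, 1)) * g z)
      - 4 * (\<Sum>z\<in>torus N. f z * g z)) / \<epsilon>\<^sup>2"
    by (simp add: sum_torus_shift[OF assms])
  also have "\<dots> = (\<Sum>z\<in>torus N. laplacian \<epsilon> N f z * g z)"
    unfolding laplacian_eq sum_divide_distrib sum.distrib[symmetric] sum_distrib_left sum_subtractf[symmetric]
    by (intro sum.cong) (auto simp: algebra_simps)
  finally show ?thesis .
qed

text \<open>Reflection turns a step into its opposite, and the set of steps is symmetric. This
  allows summation by parts in \<open>z\<close> for kernels of the form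
  \<open>p(y - z)\<close>.\<close>

lemma laplacian_reflect:
  "laplacian \<epsilon> N (\<lambda>z. f (tsub N y z)) z = laplacian \<epsilon> N f (tsub N y z)"
proof -
  have "tsub N y (tadd N z (a, b)) = tadd N (tsub N y z) (-a, -b)" for a b
    by (simp add: tsub_def tadd_def mod_simps algebra_simps)
  then show ?thesis by (simp add: laplacian_eq)
qed

section \<open>Time regularity of the heat kernel and the forward equation\<close>

lemma heat_kernel_zero: "ctrw_transition \<epsilon> N \<kappa> \<Longrightarrow> 0 < N \<Longrightarrow> heat_kernel \<kappa> 0 z = kronecker z"
  by (cases z) (auto simp: ctrw_transition_def heat_kernel_def kronecker_def)

text \<open>Chapman-Kolmogorov with the chain split at time \<open>s\<close>; the value at time
  \<open>s\<close> is written as a sum with Kronecker weights. Time increments at any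
  \<open>s\<close> are thereby governed by the short-time transition probabilities, which the
  generator controls.\<close>

lemma heat_kernel_increment:
  assumes \<kappa>: "ctrw_transition \<epsilon> N \<kappa>" and N: "0 < N" and s: "0 \<le> s" and h: "0 \<le> h" and z: "z \<in> torus N"
  shows "heat_kernel \<kappa> (s + h) z - heat_kernel \<kappa> s z
    = (\<Sum>w\<in>torus N. heat_kernel \<kappa> s w * (pmf (\<kappa> h w) z - (if w = z then 1 else 0)))"
proof -
  have "\<kappa> (s + h) (0, 0) = bind_pmf (\<kappa> s (0, 0)) (\<kappa> h)" and sub: "set_pmf (\<kappa> s (0, 0)) \<subseteq> torus N"
    using \<kappa> s h N unfolding ctrw_transition_def by auto
  then have "heat_kernel \<kappa> (s + h) z = (\<integral>w. pmf (\<kappa> h w) z \<partial>measure_pmf (\<kappa> s (0, 0)))"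
    using s h by (simp add: heat_kernel_def pmf_bind)
  also have "\<dots> = (\<Sum>w\<in>torus N. heat_kernel \<kappa> s w * pmf (\<kappa> h w) z)"
    using sub s by (subst integral_measure_pmf[of "torus N"]) (auto simp: heat_kernel_def)
  finally have "heat_kernel \<kappa> (s + h) z = (\<Sum>w\<in>torus N. heat_kernel \<kappa> s w * pmf (\<kappa> h w) z)" .
  moreover have "heat_kernel \<kappa> s z = (\<Sum>w\<in>torus N. heat_kernel \<kappa> s w * (if w = z then 1 else 0))"
    using z by (simp add: if_distrib sum.delta' cong: if_cong)
  ultimately show ?thesis
    by (simp only: right_diff_distrib sum_subtractf)
qed

text \<open>The generator applied to the indicator of \<open>z\<close>, whose expectation is the
  point probability at \<open>z\<close>.\<close>

lemma transition_increment_limit: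
  assumes \<kappa>: "ctrw_transition \<epsilon> N \<kappa>" and w: "w \<in> torus N"
  shows "((\<lambda>h. (pmf (\<kappa> h w) z - (if w = z then 1 else 0)) / h)
      \<longlongrightarrow> laplacian \<epsilon> N (\<lambda>v. if v = z then 1 else 0) w) (at_right 0)"
proof -
  have "measure_pmf.expectation M (\<lambda>v. if v = z then 1 else 0) = pmf M z" for M :: "site pmf"
    by (subst integral_measure_pmf_real[of "{z}"]) (auto split: if_splits)
  moreover have "((\<lambda>h. (measure_pmf.expectation (\<kappa> h w) f - f w) / h) \<longlongrightarrow> laplacian \<epsilon> N f w) (at_right 0)" for f
    using \<kappa> w by (auto simp: ctrw_transition_def)
  from this[of "\<lambda>v. if v = z then 1 else 0"] show ?thesis
    by (simp only: calculation)
qed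

text \<open>Needed for the left difference quotient, whose weights are \<open>p_(s - h)\<close>
  instead of \<open>p_s\<close>. As these weights lie between 0 and 1, the increment is bounded by a
  sum of short-time increments that vanish with \<open>h\<close>.\<close>

lemma heat_kernel_left_continuous:
  assumes \<kappa>: "ctrw_transition \<epsilon> N \<kappa>" and N: "0 < N" and s: "0 < s" and z: "z \<in> torus N"
  shows "((\<lambda>h. heat_kernel \<kappa> (s - h) z) \<longlongrightarrow> heat_kernel \<kappa> s z) (at_right 0)"
proof -
  let ?L = "\<lambda>h w. pmf (\<kappa> h w) z - (if w = z then 1 else 0)"
  have "((\<lambda>h. ?L h w) \<longlongrightarrow> 0) (at_right 0)" if "w \<in> torus N" for w
  proof -
    have "((\<lambda>h. ?L h w / h * h) \<longlongrightarrow> laplacian \<epsilon> N (\<lambda>v. if v = z then 1 else 0) w * 0) (at_right 0)"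
      using transition_increment_limit[OF \<kappa> that] by (intro tendsto_mult tendsto_ident_at) auto
    moreover have "\<forall>\<^sub>F h in at_right (0::real). ?L h w / h * h = ?L h w"
      by (auto simp: eventually_at_right_less eventually_at_filter)
    ultimately show ?thesis by (simp add: filterlim_cong)
  qed
  then have "((\<lambda>h. \<Sum>w\<in>torus N. \<bar>?L h w\<bar>) \<longlongrightarrow> 0) (at_right 0)"
    by (intro tendsto_null_sum tendsto_rabs_zero)
  moreover have "\<forall>\<^sub>F h in at_right 0. norm (heat_kernel \<kappa> (s - h) z - heat_kernel \<kappa> s z) \<le> (\<Sum>w\<in>torus N. \<bar>?L h w\<bar>)"
    unfolding eventually_at_right_field
  proof (intro exI[of _ s] conjI allI impI s)
    fix h assume h: "0 < h" "h < s"
    have "heat_kernel \<kappa> (s - h) z - heat_kernel \<kappa> s z = - (\<Sum>w\<in>torus N. heat_kernel \<kappa> (s - h) w * ?L h w)"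
      using heat_kernel_increment[OF \<kappa> N _ _ z, of "s - h" h] h by simp
    also have "norm \<dots> \<le> (\<Sum>w\<in>torus N. \<bar>heat_kernel \<kappa> (s - h) w * ?L h w\<bar>)"
      by simp
    also have "\<dots> \<le> (\<Sum>w\<in>torus N. \<bar>?L h w\<bar>)"
      using h by (intro sum_mono) (auto simp: heat_kernel_def abs_mult pmf_le_1 intro: mult_left_le_one_le)
    finally show "norm (heat_kernel \<kappa> (s - h) z - heat_kernel \<kappa> s z) \<le> (\<Sum>w\<in>torus N. \<bar>?L h w\<bar>)" .
  qed
  ultimately have "((\<lambda>h. heat_kernel \<kappa> (s - h) z - heat_kernel \<kappa> s z) \<longlongrightarrow> 0) (at_right 0)"
    by (rule Lim_null_comparison[rotated])
  then show ?thesis by (simp add: Lim_null[symmetric])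
qed

text \<open>The one-sided difference quotients are treated separately and glued for
  \<open>s > 0\<close>. The derivative is taken within \<open>{0..}\<close> because the kernel is
  set to 0 at negative times.\<close>

lemma heat_kernel_forward_equation:
  assumes \<kappa>: "ctrw_transition \<epsilon> N \<kappa>" and N: "0 < N" and s: "0 \<le> s" and z: "z \<in> torus N"
  shows "((\<lambda>s. heat_kernel \<kappa> s z) has_real_derivative laplacian \<epsilon> N (heat_kernel \<kappa> s) z) (at s within {0..})"
proof -
  let ?L = "\<lambda>h w. pmf (\<kappa> h w) z - (if w = z then 1 else 0)"
  let ?\<delta> = "\<lambda>v. if v = z then 1 else 0 :: real"
  \<comment> \<open>The generator acts in the starting site, which is the backward form;
    self-adjointness moves the Laplacian onto the heat kernel, and the indicator then evaluates it
    at \<open>z\<close>.\<close>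
  have gen: "(\<Sum>w\<in>torus N. heat_kernel \<kappa> s w * laplacian \<epsilon> N ?\<delta> w) = laplacian \<epsilon> N (heat_kernel \<kappa> s) z"
    using z unfolding laplacian_symmetric[OF N] by (simp add: if_distrib sum.delta' cong: if_cong)
  have "((\<lambda>h. \<Sum>w\<in>torus N. heat_kernel \<kappa> s w * (?L h w / h)) \<longlongrightarrow> laplacian \<epsilon> N (heat_kernel \<kappa> s) z) (at_right 0)"
    unfolding gen[symmetric] by (intro tendsto_sum tendsto_mult_left transition_increment_limit[OF \<kappa>])
  moreover have "\<forall>\<^sub>F h in at_right 0. (\<Sum>w\<in>torus N. heat_kernel \<kappa> s w * (?L h w / h))
      = (heat_kernel \<kappa> (h + s) z - heat_kernel \<kappa> s z) / (h + s - s)"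
    unfolding eventually_at_right_field
    using heat_kernel_increment[OF \<kappa> N s _ z]
    by (intro exI[of _ 1]) (auto simp: sum_divide_distrib add.commute)
  ultimately have right: "((\<lambda>u. (heat_kernel \<kappa> u z - heat_kernel \<kappa> s z) / (u - s))
      \<longlongrightarrow> laplacian \<epsilon> N (heat_kernel \<kappa> s) z) (at_right s)"
    unfolding filterlim_at_right_to_0[of _ _ s] by (rule Lim_transform_eventually)
  have "((\<lambda>u. (heat_kernel \<kappa> u z - heat_kernel \<kappa> s z) / (u - s))
      \<longlongrightarrow> laplacian \<epsilon> N (heat_kernel \<kappa> s) z) (at s within {0..})"
  proof (cases "s = 0")
    case True
    have "at (0::real) within {0..} = at_right 0"
      by (rule at_within_nhd[of _ UNIV]) auto
    with right True show ?thesis by simp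
  next
    case False
    then have s: "0 < s" using s by simp
    \<comment> \<open>From the left the chain is split at \<open>s - h\<close>, so the weights move
      with \<open>h\<close> too; left continuity gives their limit.\<close>
    have "((\<lambda>h. \<Sum>w\<in>torus N. heat_kernel \<kappa> (s - h) w * (?L h w / h)) \<longlongrightarrow> laplacian \<epsilon> N (heat_kernel \<kappa> s) z) (at_right 0)"
      unfolding gen[symmetric]
      by (intro tendsto_sum tendsto_mult transition_increment_limit[OF \<kappa>] heat_kernel_left_continuous[OF \<kappa> N s])
    \<comment> \<open>\<open>- (h + - s)\<close> is \<open>s - h\<close> in the shape that results
      from reflecting the left limit at \<open>s\<close> and then translating it to 0.\<close>
    moreover have "\<forall>\<^sub>F h in at_right 0. (\<Sum>w\<in>torus N. heat_kernel \<kappa> (s - h) w * (?L h w / h))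
        = (heat_kernel \<kappa> (- (h + - s)) z - heat_kernel \<kappa> s z) / (- (h + - s) - s)"
      unfolding eventually_at_right_field
    proof (intro exI[of _ s] conjI allI impI s)
      fix h assume h: "0 < h" "h < s"
      have "(\<Sum>w\<in>torus N. heat_kernel \<kappa> (s - h) w * (?L h w / h)) = (heat_kernel \<kappa> s z - heat_kernel \<kappa> (s - h) z) / h"
        using heat_kernel_increment[OF \<kappa> N _ _ z, of "s - h" h] h by (simp add: sum_divide_distrib)
      then show "(\<Sum>w\<in>torus N. heat_kernel \<kappa> (s - h) w * (?L h w / h))
        = (heat_kernel \<kappa> (- (h + - s)) z - heat_kernel \<kappa> s z) / (- (h + - s) - s)"
        using h by (simp add: field_simps)
    qed
    ultimately have "((\<lambda>u. (heat_kernel \<kappa> u z - heat_kernel \<kappa> s z) / (u - s))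
      \<longlongrightarrow> laplacian \<epsilon> N (heat_kernel \<kappa> s) z) (at_left s)"
      unfolding filterlim_at_left_to_right[of _ _ s] filterlim_at_right_to_0[of _ _ "- s"]
      by (rule Lim_transform_eventually)
    with right have "((\<lambda>u. (heat_kernel \<kappa> u z - heat_kernel \<kappa> s z) / (u - s))
      \<longlongrightarrow> laplacian \<epsilon> N (heat_kernel \<kappa> s) z) (at s)"
      by (simp add: filterlim_split_at)
    then show ?thesis by (rule filterlim_mono) (auto intro: at_le)
  qed
  then show ?thesis by (simp add: has_field_derivative_iff)
qed

lemma continuous_on_heat_kernel:
  assumes "ctrw_transition \<epsilon> N \<kappa>" "0 < N" "z \<in> torus N"
  shows "continuous_on {0..} (\<lambda>s. heat_kernel \<kappa> s z)"
  using heat_kernel_forward_equation[OF assms(1,2) _ assms(3)]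
  by (intro DERIV_continuous_on) auto

text \<open>The forward equation is one-sided at 0, so the inner function has to keep
  \<open>S\<close> inside \<open>{0..}\<close>; this covers times such as \<open>t - s\<close> up to
  the endpoint \<open>s = t\<close>.\<close>

lemma heat_kernel_chain:
  assumes "ctrw_transition \<epsilon> N \<kappa>" "0 < N" "z \<in> torus N"
    and "(g has_real_derivative d) (at s within S)" "g ` S \<subseteq> {0..}" "s \<in> S"
  shows "((\<lambda>s. heat_kernel \<kappa> (g s) z) has_real_derivative laplacian \<epsilon> N (heat_kernel \<kappa> (g s)) z * d) (at s within S)"
proof -
  have "((\<lambda>s. heat_kernel \<kappa> s z) has_real_derivative laplacian \<epsilon> N (heat_kernel \<kappa> (g s)) z) (at (g s) within g ` S)"
    using assms by (intro has_field_derivative_subset[OF heat_kernel_forward_equation]) auto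
  from DERIV_image_chain[OF this assms(4)] show ?thesis by (simp add: o_def)
qed

text \<open>
  Moving time from one factor to the other leaves the sum
  unchanged because the Laplacian is self-adjoint, and at \<open>a = 0\<close> the sum collapses.
\<close>

lemma heat_kernel_convolution:
  assumes \<kappa>: "ctrw_transition \<epsilon> N \<kappa>" and N: "0 < N" and a: "0 \<le> a" and b: "0 \<le> b"
    and y: "y \<in> torus N"
  shows "(\<Sum>z\<in>torus N. heat_kernel \<kappa> a (tsub N y z) * heat_kernel \<kappa> b (tsub N x z))
    = heat_kernel \<kappa> (a + b) (tsub N x y)"
proof -
  let ?F = "\<lambda>s. \<Sum>z\<in>torus N. heat_kernel \<kappa> s (tsub N y z) * heat_kernel \<kappa> (a + b - s) (tsub N x z)"
  have "(?F has_real_derivative 0) (at s within {0..a + b})" if s: "s \<in> {0..a + b}" for s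
  proof -
    have "(?F has_real_derivative
      (\<Sum>z\<in>torus N. laplacian \<epsilon> N (heat_kernel \<kappa> s) (tsub N y z) * 1 * heat_kernel \<kappa> (a + b - s) (tsub N x z)
         + laplacian \<epsilon> N (heat_kernel \<kappa> (a + b - s)) (tsub N x z) * (-1) * heat_kernel \<kappa> s (tsub N y z)))
       (at s within {0..a + b})"
      by (intro DERIV_sum DERIV_mult heat_kernel_chain[OF \<kappa> N])
        (use N s in \<open>auto intro!: derivative_eq_intros\<close>)
    also have "(\<Sum>z\<in>torus N. laplacian \<epsilon> N (heat_kernel \<kappa> s) (tsub N y z) * 1 * heat_kernel \<kappa> (a + b - s) (tsub N x z)
         + laplacian \<epsilon> N (heat_kernel \<kappa> (a + b - s)) (tsub N x z) * (-1) * heat_kernel \<kappa> s (tsub N y z)) = 0"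
      using laplacian_symmetric[OF N, of "\<lambda>z. heat_kernel \<kappa> s (tsub N y z)" \<epsilon> "\<lambda>z. heat_kernel \<kappa> (a + b - s) (tsub N x z)"]
      by (simp add: sum_subtractf laplacian_reflect mult.commute[of _ "heat_kernel \<kappa> s _"])
    finally show ?thesis .
  qed
  then obtain c where c: "\<forall>s\<in>{0..a + b}. ?F s = c"
    using has_field_derivative_zero_constant[of "{0..a + b}" ?F] by auto
  then have "?F a = ?F 0"
    using bspec[OF c, of a] bspec[OF c, of 0] a b by simp
  also have "\<dots> = (\<Sum>z\<in>torus N. if z = y then heat_kernel \<kappa> (a + b) (tsub N x z) else 0)"
  proof (intro sum.cong refl)
    fix z assume z: "z \<in> torus N"
    have "tsub N y z = (0, 0) \<longleftrightarrow> z = y"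
      using y z by (auto simp: tsub_def torus_def mod_eq_0_iff_dvd simp flip: mod_eq_dvd_iff)
    then show "heat_kernel \<kappa> 0 (tsub N y z) * heat_kernel \<kappa> (a + b - 0) (tsub N x z)
      = (if z = y then heat_kernel \<kappa> (a + b) (tsub N x z) else 0)"
      by (simp add: heat_kernel_zero[OF \<kappa> N] kronecker_def)
  qed
  also have "\<dots> = heat_kernel \<kappa> (a + b) (tsub N x y)"
    using y by (simp add: sum.delta')
  finally show ?thesis by simp
qed

section \<open>The covariance of the fields\<close>

locale ward_setting = prob_space \<Omega>
  for \<Omega> :: "'w measure" +
  fixes \<epsilon> T t :: real and N :: nat and \<kappa> :: "real \<Rightarrow> site \<Rightarrow> site pmf"
    and B :: "nat \<Rightarrow> site \<Rightarrow> real \<Rightarrow> 'w \<Rightarrow> real" and \<psi> :: "nat \<Rightarrow> real \<Rightarrow> site \<Rightarrow> 'w \<Rightarrow> real"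
  assumes eps: "0 < \<epsilon>" and N: "0 < N" and t: "- T < t"
    and ctrw: "ctrw_transition \<epsilon> N \<kappa>"
    and noise: "driving_noise \<Omega> \<epsilon> N (- T) B"
    and conv: "stochastic_convolution \<Omega> N T \<kappa> B \<psi>"
begin

section \<open>The explicit covariance kernel and its heat equation\<close>

definition heat_primitive :: "real \<Rightarrow> site \<Rightarrow> real" where
  "heat_primitive b z = integral {0..b} (\<lambda>u. heat_kernel \<kappa> u z)"

text \<open>The isometry and the semigroup property give the integral of
  \<open>p_u / \<epsilon>\<^sup>2\<close> at \<open>u = s + t - 2 * r\<close> over \<open>r\<close>
  from \<open>-T\<close> to \<open>s\<close>; the change of variables to \<open>u\<close> produces
  the factor 1/2 and the limits \<open>t - s\<close> and \<open>t + s + 2 * T\<close>.\<close>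

definition cov_kernel :: "real \<Rightarrow> site \<Rightarrow> real" where
  "cov_kernel s z = (heat_primitive (t + s + 2 * T) z - heat_primitive (t - s) z) / (2 * \<epsilon>\<^sup>2)"

lemma heat_primitive_zero [simp]: "heat_primitive 0 z = 0"
  by (simp add: heat_primitive_def)

lemma heat_primitive_has_derivative:
  assumes "0 \<le> b" "z \<in> torus N"
  shows "((\<lambda>b. heat_primitive b z) has_real_derivative heat_kernel \<kappa> b z) (at b within {0..})"
proof -
  \<comment> \<open>The endpoint \<open>b + 1\<close> leaves room to the right of \<open>b\<close>,
    so that this compact interval and \<open>{0..}\<close> agree near \<open>b\<close>.\<close>
  have "((\<lambda>b. heat_primitive b z) has_real_derivative heat_kernel \<kappa> b z) (at b within {0..b + 1})"
    unfolding heat_primitive_def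
    using assms continuous_on_subset[OF continuous_on_heat_kernel[OF ctrw N assms(2)], of "{0..b + 1}"]
    by (intro integral_has_real_derivative) auto
  moreover have "at b within {0..b + 1} = at b within {0..}"
    by (rule at_within_nhd[of _ "{..<b + 1}"]) auto
  ultimately show ?thesis by simp
qed

lemma heat_primitive_chain:
  assumes "z \<in> torus N" "(g has_real_derivative d) (at s within S)" "g ` S \<subseteq> {0..}" "s \<in> S"
  shows "((\<lambda>s. heat_primitive (g s) z) has_real_derivative heat_kernel \<kappa> (g s) z * d) (at s within S)"
proof -
  have "((\<lambda>s. heat_primitive s z) has_real_derivative heat_kernel \<kappa> (g s) z) (at (g s) within g ` S)"
    using assms by (intro has_field_derivative_subset[OF heat_primitive_has_derivative]) auto
  from DERIV_image_chain[OF this assms(2)] show ?thesis by (simp add: o_def)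
qed

text \<open>The forward equation integrated in time: the difference of Laplacian and heat kernel has
  derivative 0, and its value at time 0 is minus the Kronecker delta.\<close>

lemma laplacian_heat_primitive:
  assumes "0 \<le> b" and z: "z \<in> torus N"
  shows "laplacian \<epsilon> N (heat_primitive b) z = heat_kernel \<kappa> b z - kronecker z"
proof -
  let ?F = "\<lambda>b. laplacian \<epsilon> N (heat_primitive b) z - heat_kernel \<kappa> b z"
  have "(?F has_real_derivative 0) (at s within {0..})" if "s \<in> {0..}" for s
  proof -
    have s: "0 \<le> s" using that by simp
    have "(?F has_real_derivative
        laplacian \<epsilon> N (heat_kernel \<kappa> s) z - laplacian \<epsilon> N (heat_kernel \<kappa> s) z) (at s within {0..})"
      using heat_kernel_forward_equation[OF ctrw N s z] z N
      by (intro DERIV_diff) (auto simp: laplacian_eq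
          intro!: DERIV_cdivide DERIV_diff DERIV_add DERIV_cmult heat_primitive_has_derivative s)
    then show ?thesis by simp
  qed
  then obtain c where c: "\<forall>s\<in>{0..}. ?F s = c"
    using has_field_derivative_zero_constant[of "{0..}" ?F] by auto
  have "?F b = ?F 0"
    using bspec[OF c, of b] bspec[OF c, of 0] assms by simp
  then show ?thesis
    using heat_kernel_zero[OF ctrw N] by (simp add: laplacian_eq)
qed

lemma continuous_on_heat_kernel_comp:
  assumes "z \<in> torus N" "continuous_on S g" "g ` S \<subseteq> {0..}"
  shows "continuous_on S (\<lambda>s. heat_kernel \<kappa> (g s) z)"
  using continuous_on_compose2[OF continuous_on_heat_kernel[OF ctrw N assms(1)] assms(2,3)] .

text \<open>The \<open>s\<close>-derivative adds the heat kernels at the two limits, while the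
  Laplacian subtracts them, the Kronecker terms cancelling. The discrepancy is twice the kernel at
  \<open>t - s\<close>, which is the source term.\<close>

lemma cov_kernel_has_derivative:
  assumes "s \<in> {-T..t}" and z: "z \<in> torus N"
  shows "((\<lambda>s. cov_kernel s z) has_real_derivative
      laplacian \<epsilon> N (cov_kernel s) z + heat_kernel \<kappa> (t - s) z / \<epsilon>\<^sup>2) (at s within {-T..t})"
proof -
  have "((\<lambda>s. cov_kernel s z) has_real_derivative
      (heat_kernel \<kappa> (t + s + 2 * T) z * 1 - heat_kernel \<kappa> (t - s) z * (-1)) / (2 * \<epsilon>\<^sup>2)) (at s within {-T..t})"
    unfolding cov_kernel_def using assms
    by (intro DERIV_cdivide DERIV_diff heat_primitive_chain) (auto intro!: derivative_eq_intros)
  moreover have "laplacian \<epsilon> N (cov_kernel s) z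
    = (laplacian \<epsilon> N (heat_primitive (t + s + 2 * T)) z - laplacian \<epsilon> N (heat_primitive (t - s)) z) / (2 * \<epsilon>\<^sup>2)"
    by (simp add: laplacian_eq cov_kernel_def diff_divide_distrib add_divide_distrib)
  then have L: "laplacian \<epsilon> N (cov_kernel s) z
    = (heat_kernel \<kappa> (t + s + 2 * T) z - heat_kernel \<kappa> (t - s) z) / (2 * \<epsilon>\<^sup>2)"
    using assms by (simp add: laplacian_heat_primitive)
  have "(heat_kernel \<kappa> (t + s + 2 * T) z * 1 - heat_kernel \<kappa> (t - s) z * (-1)) / (2 * \<epsilon>\<^sup>2)
    = laplacian \<epsilon> N (cov_kernel s) z + heat_kernel \<kappa> (t - s) z / \<epsilon>\<^sup>2"
    unfolding L by (simp add: diff_divide_distrib add_divide_distrib)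
  ultimately show ?thesis
    by (simp only:)
qed

lemma continuous_on_cov_kernel:
  assumes "z \<in> torus N"
  shows "continuous_on {-T..t} (\<lambda>s. cov_kernel s z)"
  using cov_kernel_has_derivative[OF _ assms] by (rule DERIV_continuous_on)

text \<open>This is the sum over noise sites of the isometry terms. Summing under the integral
  merges the two kernels into one at time \<open>s + t - 2 * r\<close>.\<close>

lemma heat_kernel_overlap_integral:
  assumes s: "s \<in> {-T..t}" and x: "x \<in> torus N" and y: "y \<in> torus N"
  shows "(\<Sum>z\<in>torus N. (LBINT r:{-T..}. heat_kernel \<kappa> (s - r) (tsub N y z) * heat_kernel \<kappa> (t - r) (tsub N x z)) / \<epsilon>\<^sup>2)
    = cov_kernel s (tsub N x y)"
proof -
  let ?f = "\<lambda>z r. heat_kernel \<kappa> (s - r) (tsub N y z) * heat_kernel \<kappa> (t - r) (tsub N x z)"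
  have int: "set_integrable lborel {-T..s} (?f z)" for z
    using s N by (intro borel_integrable_atLeastAtMost' continuous_on_mult continuous_on_heat_kernel_comp)
      (auto intro!: continuous_intros)
  \<comment> \<open>Noise after time \<open>s\<close> does not enter the earlier field: its kernel
    vanishes at negative times.\<close>
  have "(LBINT r:{-T..}. ?f z r) = (LBINT r:{-T..s}. ?f z r)" for z
    unfolding set_lebesgue_integral_def
    by (intro Bochner_Integration.integral_cong) (auto simp: indicator_def heat_kernel_def)
  then have "(\<Sum>z\<in>torus N. (LBINT r:{-T..}. ?f z r) / \<epsilon>\<^sup>2) = (\<Sum>z\<in>torus N. LBINT r:{-T..s}. ?f z r) / \<epsilon>\<^sup>2"
    by (simp add: sum_divide_distrib)
  also have "(\<Sum>z\<in>torus N. LBINT r:{-T..s}. ?f z r) = (LBINT r:{-T..s}. \<Sum>z\<in>torus N. ?f z r)"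
    using int unfolding set_lebesgue_integral_def set_integrable_def scaleR_sum_right
    by (intro Bochner_Integration.integral_sum[symmetric])
  also have "\<dots> = (LBINT r:{-T..s}. heat_kernel \<kappa> (s + t - 2 * r) (tsub N x y))"
  proof (rule set_lebesgue_integral_cong)
    show "\<forall>r. r \<in> {-T..s} \<longrightarrow> (\<Sum>z\<in>torus N. ?f z r) = heat_kernel \<kappa> (s + t - 2 * r) (tsub N x y)"
      using heat_kernel_convolution[OF ctrw N _ _ y] s by (simp add: algebra_simps)
  qed simp
  \<comment> \<open>Antiderivative in \<open>r\<close>; the inner derivative -2 accounts for the
    factor -1/2.\<close>
  also have "\<dots> = - heat_primitive (s + t - 2 * s) (tsub N x y) / 2 - (- heat_primitive (s + t - 2 * (-T)) (tsub N x y) / 2)"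
    unfolding set_lebesgue_integral_def
  proof (rule integral_FTC_atLeastAtMost)
    fix r assume r: "- T \<le> r" "r \<le> s"
    have "((\<lambda>r. - heat_primitive (s + t - 2 * r) (tsub N x y) / 2) has_real_derivative
      - (heat_kernel \<kappa> (s + t - 2 * r) (tsub N x y) * (- 2)) / 2) (at r within {-T..s})"
      using r s N by (intro DERIV_cdivide DERIV_minus heat_primitive_chain) (auto intro!: derivative_eq_intros)
    then show "((\<lambda>r. - heat_primitive (s + t - 2 * r) (tsub N x y) / 2) has_vector_derivative
      heat_kernel \<kappa> (s + t - 2 * r) (tsub N x y)) (at r within {-T..s})"
      by (simp add: has_real_derivative_iff_has_vector_derivative)
  next
    show "continuous_on {-T..s} (\<lambda>r. heat_kernel \<kappa> (s + t - 2 * r) (tsub N x y))"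
      using s N by (intro continuous_on_heat_kernel_comp) (auto intro!: continuous_intros)
  qed (use s in auto)
  finally show ?thesis
    by (simp add: cov_kernel_def diff_divide_distrib algebra_simps)
qed

text \<open>Both fields are almost surely sums over sites of Wiener integrals. In the double sum
  independence kills the terms with distinct sites, and the diagonal is the overlap
  integral.\<close>

lemma field_square_integrable_and_covariance:
  assumes k: "k \<in> {1, 2}" and s: "s \<in> {-T..t}" and x: "x \<in> torus N" and y: "y \<in> torus N"
  shows "square_integrable \<Omega> (\<psi> k s y) \<and> (\<integral>\<omega>. \<psi> k s y \<omega> * \<psi> k t x \<omega> \<partial>\<Omega>) = cov_kernel s (tsub N x y)"
proof -
  have ex: "\<psi> k s y \<in> borel_measurable \<Omega> \<and>
      (\<exists>I. (\<forall>z\<in>torus N. has_wiener_integral \<Omega> (-T) (B k z) (\<lambda>r. heat_kernel \<kappa> (s - r) (tsub N y z)) (I z)) \<and>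
         (AE \<omega> in \<Omega>. \<psi> k s y \<omega> = (\<Sum>z\<in>torus N. I z \<omega>)))"
    if "-T \<le> s" "y \<in> torus N" for s y
    using conv k that unfolding stochastic_convolution_def by blast
  have "-T \<le> s" "-T \<le> t" using s t by auto
  from ex[OF this(1) y] ex[OF this(2) x]
  have m: "\<psi> k s y \<in> borel_measurable \<Omega>" "\<psi> k t x \<in> borel_measurable \<Omega>"
    by simp_all
  from ex[OF \<open>-T \<le> s\<close> y] obtain I where
      I: "\<And>z. z \<in> torus N \<Longrightarrow> has_wiener_integral \<Omega> (-T) (B k z) (\<lambda>r. heat_kernel \<kappa> (s - r) (tsub N y z)) (I z)"
        "AE \<omega> in \<Omega>. \<psi> k s y \<omega> = (\<Sum>z\<in>torus N. I z \<omega>)"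
    by blast
  from ex[OF \<open>-T \<le> t\<close> x] obtain J where
      J: "\<And>z. z \<in> torus N \<Longrightarrow> has_wiener_integral \<Omega> (-T) (B k z) (\<lambda>r. heat_kernel \<kappa> (t - r) (tsub N x z)) (J z)"
        "AE \<omega> in \<Omega>. \<psi> k t x \<omega> = (\<Sum>z\<in>torus N. J z \<omega>)"
    by blast
  note IJ = driving_noise_covariance[OF prob_space_axioms eps noise k]
  have sI: "square_integrable \<Omega> (I z)" and sJ: "square_integrable \<Omega> (J z)" if "z \<in> torus N" for z
    using IJ(1,2)[OF that that I(1)[OF that] J(1)[OF that]] by auto
  have cov: "(\<integral>\<omega>. I z \<omega> * J w \<omega> \<partial>\<Omega>) = (if z = w then
        (LBINT r:{-T..}. heat_kernel \<kappa> (s - r) (tsub N y z) * heat_kernel \<kappa> (t - r) (tsub N x w)) / \<epsilon>\<^sup>2 else 0)"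
    if "z \<in> torus N" "w \<in> torus N" for z w
    by (rule IJ(3)[OF that I(1)[OF that(1)] J(1)[OF that(2)]])
  have "square_integrable \<Omega> (\<psi> k s y)"
    by (rule square_integrable_cong_AE[OF square_integrable_sum[OF sI] m(1) I(2)])
  moreover have "(\<integral>\<omega>. \<psi> k s y \<omega> * \<psi> k t x \<omega> \<partial>\<Omega>) = cov_kernel s (tsub N x y)"
  proof -
    have mI: "I z \<in> borel_measurable \<Omega>" "J z \<in> borel_measurable \<Omega>" if "z \<in> torus N" for z
      using sI[OF that] sJ[OF that] by (auto simp: square_integrable_def)
    have "(\<integral>\<omega>. \<psi> k s y \<omega> * \<psi> k t x \<omega> \<partial>\<Omega>) = (\<integral>\<omega>. (\<Sum>z\<in>torus N. I z \<omega>) * (\<Sum>z\<in>torus N. J z \<omega>) \<partial>\<Omega>)"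
      using I(2) J(2) m mI by (intro integral_cong_AE) auto
    also have "\<dots> = (\<integral>\<omega>. (\<Sum>z\<in>torus N. \<Sum>w\<in>torus N. I z \<omega> * J w \<omega>) \<partial>\<Omega>)"
      by (simp add: sum_product)
    also have "\<dots> = (\<Sum>z\<in>torus N. \<Sum>w\<in>torus N. \<integral>\<omega>. I z \<omega> * J w \<omega> \<partial>\<Omega>)"
      using square_integrable_mult[OF sI sJ] by (simp add: Bochner_Integration.integral_sum)
    also have "\<dots> = (\<Sum>z\<in>torus N. \<Sum>w\<in>torus N. if z = w then
        (LBINT r:{-T..}. heat_kernel \<kappa> (s - r) (tsub N y z) * heat_kernel \<kappa> (t - r) (tsub N x w)) / \<epsilon>\<^sup>2 else 0)"
      by (intro sum.cong refl cov)
    also have "\<dots> = cov_kernel s (tsub N x y)"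
      unfolding heat_kernel_overlap_integral[OF s x y, symmetric] by (simp add: sum.delta)
    finally show ?thesis .
  qed
  ultimately show ?thesis ..
qed

lemmas field_square_integrable = field_square_integrable_and_covariance[THEN conjunct1]
lemmas field_covariance = field_square_integrable_and_covariance[THEN conjunct2]

text \<open>Makes it legitimate to expand discrete derivatives under the expectation.\<close>

lemma field_covariance_integrable:
  assumes "k \<in> {1, 2}" "s \<in> {-T..t}" "x \<in> torus N" "y \<in> torus N"
  shows "integrable \<Omega> (\<lambda>\<omega>. \<psi> k s y \<omega> * \<psi> k t x \<omega>)"
  using assms t by (intro square_integrable_mult field_square_integrable) auto

text \<open>This is \<open>S(z, w)\<close> of the overview. The range stops at \<open>t\<close>,
  where the heat kernel is cut off and up to which \<open>cov_kernel\<close> represents the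
  covariance.\<close>

definition ward_pairing :: "site \<Rightarrow> site \<Rightarrow> real" where
  "ward_pairing z w = (LBINT s:{-T..t}. heat_kernel \<kappa> (t - s) z * cov_kernel s w)"

lemma ward_pairing_integrable:
  assumes "z \<in> torus N" "w \<in> torus N"
  shows "set_integrable lborel {-T..t} (\<lambda>s. heat_kernel \<kappa> (t - s) z * cov_kernel s w)"
  using assms
  by (intro borel_integrable_atLeastAtMost' continuous_on_mult continuous_on_cov_kernel continuous_on_heat_kernel_comp)
    (auto intro!: continuous_intros)

lemma laplacian_set_integral:
  assumes "\<And>e. set_integrable lborel A (\<lambda>s. F s (tadd N z e))" "set_integrable lborel A (\<lambda>s. F s z)"
  shows "laplacian \<epsilon> N (\<lambda>z. LBINT s:A. F s z) z = (LBINT s:A. laplacian \<epsilon> N (F s) z)"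
    and "set_integrable lborel A (\<lambda>s. laplacian \<epsilon> N (F s) z)"
  using assms by (simp_all add: laplacian_eq)

text \<open>Fundamental theorem of calculus for the product of kernel and covariance: the kernel
  runs backwards in \<open>s\<close> and contributes the Laplacian in \<open>z\<close> with a minus
  sign, the covariance contributes the Laplacian in \<open>w\<close> and the source term.\<close>

lemma ward_pairing_laplacian:
  assumes z: "z \<in> torus N" and w: "w \<in> torus N"
  shows "laplacian \<epsilon> N (ward_pairing z) w - laplacian \<epsilon> N (\<lambda>z. ward_pairing z w) z
    = kronecker z * cov_kernel t w
      - (LBINT s:{-T..t}. heat_kernel \<kappa> (t - s) z * heat_kernel \<kappa> (t - s) w) / \<epsilon>\<^sup>2"
proof -
  let ?p = "\<lambda>s. heat_kernel \<kappa> (t - s)"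
  note int = ward_pairing_integrable
  have cp: "continuous_on {-T..t} (\<lambda>s. ?p s v)" if "v \<in> torus N" for v
    using that by (intro continuous_on_heat_kernel_comp) (auto intro!: continuous_intros)
  have ipp: "set_integrable lborel {-T..t} (\<lambda>s. ?p s z * ?p s w)"
    by (intro borel_integrable_atLeastAtMost' continuous_on_mult cp z w)
  have lw: "laplacian \<epsilon> N (\<lambda>v. ?p s z * cov_kernel s v) w = ?p s z * laplacian \<epsilon> N (cov_kernel s) w" for s
    by (simp add: laplacian_eq algebra_simps)
  have lz: "laplacian \<epsilon> N (\<lambda>v. ?p s v * cov_kernel s w) z = laplacian \<epsilon> N (?p s) z * cov_kernel s w" for s
    by (simp add: laplacian_eq algebra_simps)
  have Lw: "laplacian \<epsilon> N (ward_pairing z) w = (LBINT s:{-T..t}. ?p s z * laplacian \<epsilon> N (cov_kernel s) w)"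
    and iw: "set_integrable lborel {-T..t} (\<lambda>s. ?p s z * laplacian \<epsilon> N (cov_kernel s) w)"
    using laplacian_set_integral[of "{-T..t}" "\<lambda>s v. ?p s z * cov_kernel s v" w] int z w N
    unfolding lw ward_pairing_def[abs_def] by auto
  have Lz: "laplacian \<epsilon> N (\<lambda>z. ward_pairing z w) z = (LBINT s:{-T..t}. laplacian \<epsilon> N (?p s) z * cov_kernel s w)"
    and iz: "set_integrable lborel {-T..t} (\<lambda>s. laplacian \<epsilon> N (?p s) z * cov_kernel s w)"
    using laplacian_set_integral[of "{-T..t}" "\<lambda>s v. ?p s v * cov_kernel s w" z] int z w N
    unfolding lz ward_pairing_def[abs_def] by auto
  let ?g = "\<lambda>s. ?p s z * laplacian \<epsilon> N (cov_kernel s) w - laplacian \<epsilon> N (?p s) z * cov_kernel s w + ?p s z * ?p s w / \<epsilon>\<^sup>2"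
  have "(LBINT s:{-T..t}. ?g s) = ?p t z * cov_kernel t w - ?p (-T) z * cov_kernel (-T) w"
    unfolding set_lebesgue_integral_def
  proof (rule integral_FTC_atLeastAtMost)
    fix s assume s: "-T \<le> s" "s \<le> t"
    have "((\<lambda>s. ?p s z * cov_kernel s w) has_real_derivative
       laplacian \<epsilon> N (?p s) z * (-1) * cov_kernel s w
       + (laplacian \<epsilon> N (cov_kernel s) w + ?p s w / \<epsilon>\<^sup>2) * ?p s z) (at s within {-T..t})"
      using s z w by (intro DERIV_mult heat_kernel_chain[OF ctrw N] cov_kernel_has_derivative)
        (auto intro!: derivative_eq_intros)
    also have "laplacian \<epsilon> N (?p s) z * (-1) * cov_kernel s w
       + (laplacian \<epsilon> N (cov_kernel s) w + ?p s w / \<epsilon>\<^sup>2) * ?p s z = ?g s"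
      by (simp add: algebra_simps)
    finally show "((\<lambda>s. ?p s z * cov_kernel s w) has_vector_derivative ?g s) (at s within {-T..t})"
      by (simp add: has_real_derivative_iff_has_vector_derivative)
  next
    show "continuous_on {-T..t} ?g"
      unfolding laplacian_eq using z w N eps
      by (intro continuous_intros cp continuous_on_cov_kernel) auto
  qed (use t in auto)
  moreover have "(LBINT s:{-T..t}. ?g s) = laplacian \<epsilon> N (ward_pairing z) w - laplacian \<epsilon> N (\<lambda>z. ward_pairing z w) z
      + (LBINT s:{-T..t}. ?p s z * ?p s w) / \<epsilon>\<^sup>2"
    unfolding Lw Lz using iw iz ipp by simp
  \<comment> \<open>The zero initial condition: at \<open>s = -T\<close> both limits of the
    covariance integral equal \<open>t + T\<close>.\<close>
  moreover have "cov_kernel (-T) w = 0"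
    by (simp add: cov_kernel_def add.commute)
  moreover have "?p t z = kronecker z"
    using heat_kernel_zero[OF ctrw N] by simp
  ultimately show ?thesis by simp
qed

end

section \<open>The Ward identity\<close>

text \<open>Sites are lifted to the group of integer pairs, where sums are normalised, and reduced
  modulo \<open>N\<close> once at the end.\<close>

definition torus_mod :: "nat \<Rightarrow> site \<Rightarrow> site" where
  "torus_mod N z = (fst z mod int N, snd z mod int N)"

lemma tadd_eq_torus_mod: "tadd N x y = torus_mod N (x + y)"
  by (simp add: tadd_def torus_mod_def)

lemma tsub_eq_torus_mod: "tsub N x y = torus_mod N (x - y)"
  by (simp add: tsub_def torus_mod_def)

lemma torus_mod_simps [simp]:
  "torus_mod N (torus_mod N z) = torus_mod N z"
  "torus_mod N (- torus_mod N z) = torus_mod N (- z)"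
  "torus_mod N (torus_mod N z + w) = torus_mod N (z + w)"
  "torus_mod N (w + torus_mod N z) = torus_mod N (w + z)"
  "torus_mod N (torus_mod N z - w) = torus_mod N (z - w)"
  "torus_mod N (w - torus_mod N z) = torus_mod N (w - z)"
  by (simp_all add: torus_mod_def mod_simps)

lemma torus_mod_in_torus [simp]: "0 < N \<Longrightarrow> torus_mod N z \<in> torus N"
  by (simp add: torus_def torus_mod_def)

lemma kronecker_torus_mod_minus: "kronecker (torus_mod N (- z)) = kronecker (torus_mod N z)"
  by (simp add: torus_mod_def kronecker_def mod_eq_0_iff_dvd)

lemma set_integral_atLeast_eq_Icc:
  fixes F G :: "real \<Rightarrow> real"
  assumes "\<And>s. s \<in> {a..b} \<Longrightarrow> F s = G s" "\<And>s. b < s \<Longrightarrow> F s = 0"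
  shows "(LBINT s:{a..}. F s) = (LBINT s:{a..b}. G s)"
  unfolding set_lebesgue_integral_def
  using assms by (intro Bochner_Integration.integral_cong) (auto simp: indicator_def)

context ward_setting
begin

text \<open>The equal-time covariance across an edge in direction \<open>l\<close>, as in the first
  line of \<open>V\<close>.\<close>

definition edge_cov :: "nat \<Rightarrow> real" where
  "edge_cov l = cov_kernel t (torus_mod N (unit_step l))"

text \<open>
  The offsets \<open>p\<close>, \<open>q\<close> move the arguments of the heat kernel and of the covariance independently, so
  that the Laplacians in the two arguments of the pairing can be told apart.
\<close>

definition ward_density :: "nat \<Rightarrow> site \<Rightarrow> site \<Rightarrow> real" where
  "ward_density j p q = ward_pairing (torus_mod N p) (torus_mod N (q + unit_step j))
     - ward_pairing (torus_mod N (p + unit_step j)) (torus_mod N q)"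

text \<open>Evenness comes from commuting the two factors inside the equal-time expectation.\<close>

lemma edge_cov_reflect: "edge_cov l = cov_kernel t (torus_mod N (- unit_step l))"
proof -
  have 1: "(1::nat) \<in> {1, 2}" and tt: "t \<in> {-T..t}" using t by auto
  have "cov_kernel t (tsub N (torus_mod N (unit_step l)) (0, 0)) = cov_kernel t (tsub N (0, 0) (torus_mod N (unit_step l)))"
    using field_covariance[OF 1 tt, of "torus_mod N (unit_step l)" "(0, 0)"]
      field_covariance[OF 1 tt, of "(0, 0)" "torus_mod N (unit_step l)"] N
    by (simp add: mult.commute)
  then show ?thesis
    by (simp add: edge_cov_def tsub_eq_torus_mod flip: zero_prod_def)
qed

text \<open>The pairing identity is used at the arguments \<open>(z, z + u)\<close> and
  \<open>(z + u, z)\<close>, with \<open>u\<close> the unit step, and subtracted. The integral of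
  the product of two heat kernels is the same in both and drops out.\<close>

lemma ward_density_balance:
  "(\<Sum>e\<in>{(1, 0), (-1, 0), (0, 1), (0, -1)}. ward_density j z (z + e) - ward_density j (z + e) z) / \<epsilon>\<^sup>2
    = (kronecker (torus_mod N z) - kronecker (torus_mod N (z + unit_step j))) * edge_cov j"
proof -
  let ?m = "torus_mod N" and ?u = "unit_step j"
  have K: "laplacian \<epsilon> N (ward_pairing (?m z)) (?m w) - laplacian \<epsilon> N (\<lambda>z. ward_pairing z (?m w)) (?m z)
    = kronecker (?m z) * cov_kernel t (?m w)
      - (LBINT s:{-T..t}. heat_kernel \<kappa> (t - s) (?m z) * heat_kernel \<kappa> (t - s) (?m w)) / \<epsilon>\<^sup>2" for z w
    using N by (intro ward_pairing_laplacian) auto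
  \<comment> \<open>The Kronecker factor fixes the argument of the covariance: \<open>z\<close> is 0
    modulo \<open>N\<close>.\<close>
  have k: "kronecker (?m z) * cov_kernel t (?m (z + ?u)) = kronecker (?m z) * edge_cov j"
  proof -
    have "?m (z + ?u) = ?m ?u" if "?m z = (0, 0)"
      using torus_mod_simps(3)[of N z ?u] unfolding that by (simp flip: zero_prod_def)
    then show ?thesis by (auto simp: kronecker_def edge_cov_def)
  qed
  \<comment> \<open>Here \<open>z\<close> is \<open>-u\<close> modulo \<open>N\<close>, and evenness
    of the covariance gives the same constant.\<close>
  have k': "kronecker (?m (z + ?u)) * cov_kernel t (?m z) = kronecker (?m (z + ?u)) * edge_cov j"
  proof -
    have "?m z = ?m (- ?u)" if "?m (z + ?u) = (0, 0)"
      using torus_mod_simps(5)[of N "z + ?u" ?u] unfolding that by (simp flip: zero_prod_def)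
    then show ?thesis by (auto simp: kronecker_def edge_cov_reflect)
  qed
  \<comment> \<open>The left side has no central terms; on the right those of the Laplacians in the
    two arguments cancel pairwise.\<close>
  have "(\<Sum>e\<in>{(1, 0), (-1, 0), (0, 1), (0, -1)}. ward_density j z (z + e) - ward_density j (z + e) z) / \<epsilon>\<^sup>2
    = (laplacian \<epsilon> N (ward_pairing (?m z)) (?m (z + ?u)) - laplacian \<epsilon> N (\<lambda>v. ward_pairing v (?m (z + ?u))) (?m z))
     - (laplacian \<epsilon> N (ward_pairing (?m (z + ?u))) (?m z) - laplacian \<epsilon> N (\<lambda>v. ward_pairing v (?m z)) (?m (z + ?u)))"
    unfolding laplacian_eq ward_density_def tadd_eq_torus_mod
    by (simp add: diff_divide_distrib add_divide_distrib ac_simps)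
  also have "\<dots> = (kronecker (?m z) - kronecker (?m (z + ?u))) * edge_cov j"
    unfolding K k k' by (simp add: left_diff_distrib mult.commute[of "heat_kernel _ _ (?m (z + ?u))"])
  finally show ?thesis .
qed

text \<open>All time integrals in \<open>U\<close> and \<open>V\<close> have this shape: four
  products of kernel and covariance, cut off at \<open>t\<close> by the kernel.\<close>

lemma ward_pairing_combination:
  assumes "\<And>s. s \<in> {-T..t} \<Longrightarrow> F s =
       (heat_kernel \<kappa> (t - s) a * cov_kernel s a' - heat_kernel \<kappa> (t - s) b * cov_kernel s b'
        - heat_kernel \<kappa> (t - s) c * cov_kernel s c' + heat_kernel \<kappa> (t - s) d * cov_kernel s d') / r"
    and "\<And>s. t < s \<Longrightarrow> F s = 0"
    and "{a, b, c, d, a', b', c', d'} \<subseteq> torus N"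
  shows "(LBINT s:{-T..}. F s) = (ward_pairing a a' - ward_pairing b b' - ward_pairing c c' + ward_pairing d d') / r"
proof -
  have "(LBINT s:{-T..}. F s) = (LBINT s:{-T..t}.
      (heat_kernel \<kappa> (t - s) a * cov_kernel s a' - heat_kernel \<kappa> (t - s) b * cov_kernel s b'
        - heat_kernel \<kappa> (t - s) c * cov_kernel s c' + heat_kernel \<kappa> (t - s) d * cov_kernel s d') / r)"
    by (rule set_integral_atLeast_eq_Icc[OF assms(1,2)])
  also have "\<dots> = (ward_pairing a a' - ward_pairing b b' - ward_pairing c c' + ward_pairing d d') / r"
    using assms(3) ward_pairing_integrable unfolding ward_pairing_def by simp
  finally show ?thesis .
qed

section \<open>The fields of the identity in terms of the pairing\<close>

lemma nabla_heat_kernel_future: "t < s \<Longrightarrow> nabla \<epsilon> N j (heat_kernel \<kappa> (t - s)) z = 0"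
  by (simp add: nabla_def heat_kernel_def)

lemma heat_kernel_future: "t < s \<Longrightarrow> heat_kernel \<kappa> (t - s) z = 0"
  by (simp add: heat_kernel_def)

text \<open>The covariance depends on \<open>x - y\<close> alone, so a forward difference at
  \<open>x\<close> shifts \<open>z\<close> by a positive step and one at \<open>y\<close> by a
  negative step. Any representative \<open>z\<close> modulo \<open>N\<close> is allowed, so that
  shifted base points can be inserted directly.\<close>

lemma field_nabla_covariance:
  assumes k: "k \<in> {1, 2}" and s: "s \<in> {-T..t}" and x: "x \<in> torus N" and y: "y \<in> torus N"
    and z: "tsub N x y = torus_mod N z"
  shows "(\<integral>\<omega>. \<psi> k s y \<omega> * \<psi> k t x \<omega> \<partial>\<Omega>) = cov_kernel s (torus_mod N z)"
    and "(\<integral>\<omega>. \<psi> k s y \<omega> * nabla \<epsilon> N j (\<lambda>z. \<psi> k t z \<omega>) x \<partial>\<Omega>)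
      = (cov_kernel s (torus_mod N (z + unit_step j)) - cov_kernel s (torus_mod N z)) / \<epsilon>"
    and "(\<integral>\<omega>. nabla \<epsilon> N l (\<lambda>z. \<psi> k s z \<omega>) y * \<psi> k t x \<omega> \<partial>\<Omega>)
      = (cov_kernel s (torus_mod N (z - unit_step l)) - cov_kernel s (torus_mod N z)) / \<epsilon>"
    and "(\<integral>\<omega>. nabla \<epsilon> N l (\<lambda>z. \<psi> k s z \<omega>) y * nabla \<epsilon> N j (\<lambda>z. \<psi> k t z \<omega>) x \<partial>\<Omega>)
      = ((cov_kernel s (torus_mod N (z - unit_step l + unit_step j)) - cov_kernel s (torus_mod N (z - unit_step l)))
        - (cov_kernel s (torus_mod N (z + unit_step j)) - cov_kernel s (torus_mod N z))) / \<epsilon>\<^sup>2"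
proof -
  note int = field_covariance_integrable[OF k s] and cov = field_covariance[OF k s]
  have zz: "torus_mod N (x - y + w) = torus_mod N (z + w)" for w
    using z by (metis tsub_eq_torus_mod torus_mod_simps(3))
  have shift: "torus_mod N (x + v - y) = torus_mod N (z + v)" "torus_mod N (x - (y + w)) = torus_mod N (z - w)"
    "torus_mod N (x + v - (y + w)) = torus_mod N (z - w + v)" for v w
    using zz[of v] zz[of "- w"] zz[of "v - w"] by (simp_all add: algebra_simps)
  show 1: "(\<integral>\<omega>. \<psi> k s y \<omega> * \<psi> k t x \<omega> \<partial>\<Omega>) = cov_kernel s (torus_mod N z)"
    using cov[OF x y] z by simp
  show "(\<integral>\<omega>. \<psi> k s y \<omega> * nabla \<epsilon> N j (\<lambda>z. \<psi> k t z \<omega>) x \<partial>\<Omega>)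
      = (cov_kernel s (torus_mod N (z + unit_step j)) - cov_kernel s (torus_mod N z)) / \<epsilon>"
    using x y N int 1
    by (simp add: nabla_def right_diff_distrib cov tadd_eq_torus_mod tsub_eq_torus_mod shift)
  show "(\<integral>\<omega>. nabla \<epsilon> N l (\<lambda>z. \<psi> k s z \<omega>) y * \<psi> k t x \<omega> \<partial>\<Omega>)
      = (cov_kernel s (torus_mod N (z - unit_step l)) - cov_kernel s (torus_mod N z)) / \<epsilon>"
    using x y N int 1
    by (simp add: nabla_def left_diff_distrib cov tadd_eq_torus_mod tsub_eq_torus_mod shift)
  show "(\<integral>\<omega>. nabla \<epsilon> N l (\<lambda>z. \<psi> k s z \<omega>) y * nabla \<epsilon> N j (\<lambda>z. \<psi> k t z \<omega>) x \<partial>\<Omega>)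
      = ((cov_kernel s (torus_mod N (z - unit_step l + unit_step j)) - cov_kernel s (torus_mod N (z - unit_step l)))
        - (cov_kernel s (torus_mod N (z + unit_step j)) - cov_kernel s (torus_mod N z))) / \<epsilon>\<^sup>2"
    using x y N int 1
    by (simp add: nabla_def left_diff_distrib right_diff_distrib cov tadd_eq_torus_mod tsub_eq_torus_mod shift power2_eq_square diff_divide_distrib)
qed

lemma nabla_torus_mod: "nabla \<epsilon> N j f (torus_mod N z) = (f (torus_mod N (z + unit_step j)) - f (torus_mod N z)) / \<epsilon>"
  by (simp add: nabla_def tadd_eq_torus_mod)

text \<open>The products without a shift cancel, leaving the antisymmetrised pairing. The factor 2
  counts the two field components.\<close>

lemma ward_U_eq:
  assumes x: "x \<in> torus N" and y: "y \<in> torus N" and z: "tsub N x y = torus_mod N z"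
  shows "ward_U \<Omega> \<epsilon> N T \<kappa> \<psi> t x y = 2 / \<epsilon> * (\<Sum>j\<in>{1, 2}. ward_density j z z)"
proof -
  let ?m = "torus_mod N"
  have "(LBINT s:{-T..}. heat_kernel \<kappa> (t - s) (tsub N x y) *
          (\<integral>\<omega>. \<psi> k s y \<omega> * nabla \<epsilon> N j (\<lambda>z. \<psi> k t z \<omega>) x \<partial>\<Omega>)
        - nabla \<epsilon> N j (heat_kernel \<kappa> (t - s)) (tsub N x y) *
          (\<integral>\<omega>. \<psi> k s y \<omega> * \<psi> k t x \<omega> \<partial>\<Omega>))
      = (ward_pairing (?m z) (?m (z + unit_step j)) - ward_pairing (?m z) (?m z)
         - ward_pairing (?m (z + unit_step j)) (?m z) + ward_pairing (?m z) (?m z)) / \<epsilon>"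
    if k: "k \<in> {1, 2}" for j k
  proof (rule ward_pairing_combination)
    fix s assume s: "s \<in> {-T..t}"
    show "heat_kernel \<kappa> (t - s) (tsub N x y) *
          (\<integral>\<omega>. \<psi> k s y \<omega> * nabla \<epsilon> N j (\<lambda>z. \<psi> k t z \<omega>) x \<partial>\<Omega>)
        - nabla \<epsilon> N j (heat_kernel \<kappa> (t - s)) (tsub N x y) *
          (\<integral>\<omega>. \<psi> k s y \<omega> * \<psi> k t x \<omega> \<partial>\<Omega>)
      = (heat_kernel \<kappa> (t - s) (?m z) * cov_kernel s (?m (z + unit_step j))
         - heat_kernel \<kappa> (t - s) (?m z) * cov_kernel s (?m z)
         - heat_kernel \<kappa> (t - s) (?m (z + unit_step j)) * cov_kernel s (?m z)
         + heat_kernel \<kappa> (t - s) (?m z) * cov_kernel s (?m z)) / \<epsilon>"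
      unfolding field_nabla_covariance(1,2)[OF k s x y z] z nabla_torus_mod
      by (simp add: algebra_simps diff_divide_distrib add_divide_distrib)
  qed (use N in \<open>auto simp: nabla_heat_kernel_future heat_kernel_future\<close>)
  then show ?thesis
    by (simp add: ward_U_def ward_Uj_def ward_density_def add_divide_distrib diff_divide_distrib)
qed

text \<open>In the difference of the two integral lines the products without a shift by
  \<open>unit_step j\<close> cancel, leaving \<open>ward_density\<close> differenced along the edge
  in its second argument. The sum over \<open>e\<close> places the first argument at both ends of
  the edge, as the discrete product rule requires.\<close>

lemma ward_V_eq:
  assumes x: "x \<in> torus N" and y: "y \<in> torus N" and z: "tsub N x y = torus_mod N z" and l: "l \<in> {1, 2}"
  shows "ward_V \<Omega> \<epsilon> N T \<kappa> \<psi> t x l y = - 2 * kronecker (torus_mod N z) * edge_cov l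
    + 2 / \<epsilon>\<^sup>2 * (\<Sum>j\<in>{1, 2}. \<Sum>e\<in>{(0, 0), unit_step l}.
        ward_density j (z - e) (z - unit_step l) - ward_density j (z - e) z)"
proof -
  let ?m = "torus_mod N" and ?u = "unit_step l"
  have ze: "tsub N (tsub N x y) e = ?m (z - e)" for e
    by (simp only: z) (simp add: tsub_eq_torus_mod)
  have A: "(LBINT s:{-T..}. nabla \<epsilon> N j (heat_kernel \<kappa> (t - s)) (tsub N (tsub N x y) e) *
            (\<integral>\<omega>. nabla \<epsilon> N l (\<lambda>z. \<psi> k s z \<omega>) y * \<psi> k t x \<omega> \<partial>\<Omega>))
      = (ward_pairing (?m (z - e + unit_step j)) (?m (z - ?u)) - ward_pairing (?m (z - e + unit_step j)) (?m z)
         - ward_pairing (?m (z - e)) (?m (z - ?u)) + ward_pairing (?m (z - e)) (?m z)) / \<epsilon>\<^sup>2"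
    if k: "k \<in> {1, 2}" for j k e
  proof (rule ward_pairing_combination)
    fix s assume s: "s \<in> {-T..t}"
    show "nabla \<epsilon> N j (heat_kernel \<kappa> (t - s)) (tsub N (tsub N x y) e) *
            (\<integral>\<omega>. nabla \<epsilon> N l (\<lambda>z. \<psi> k s z \<omega>) y * \<psi> k t x \<omega> \<partial>\<Omega>)
      = (heat_kernel \<kappa> (t - s) (?m (z - e + unit_step j)) * cov_kernel s (?m (z - ?u))
         - heat_kernel \<kappa> (t - s) (?m (z - e + unit_step j)) * cov_kernel s (?m z)
         - heat_kernel \<kappa> (t - s) (?m (z - e)) * cov_kernel s (?m (z - ?u))
         + heat_kernel \<kappa> (t - s) (?m (z - e)) * cov_kernel s (?m z)) / \<epsilon>\<^sup>2"
      unfolding field_nabla_covariance(3)[OF k s x y z] ze nabla_torus_mod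
      by (simp add: algebra_simps diff_divide_distrib add_divide_distrib power2_eq_square)
  qed (use N in \<open>auto simp: nabla_heat_kernel_future\<close>)
  have B: "(LBINT s:{-T..}. heat_kernel \<kappa> (t - s) (tsub N (tsub N x y) e) *
            (\<integral>\<omega>. nabla \<epsilon> N l (\<lambda>z. \<psi> k s z \<omega>) y * nabla \<epsilon> N j (\<lambda>z. \<psi> k t z \<omega>) x \<partial>\<Omega>))
      = (ward_pairing (?m (z - e)) (?m (z - ?u + unit_step j)) - ward_pairing (?m (z - e)) (?m (z - ?u))
         - ward_pairing (?m (z - e)) (?m (z + unit_step j)) + ward_pairing (?m (z - e)) (?m z)) / \<epsilon>\<^sup>2"
    if k: "k \<in> {1, 2}" for j k e
  proof (rule ward_pairing_combination)
    fix s assume s: "s \<in> {-T..t}"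
    show "heat_kernel \<kappa> (t - s) (tsub N (tsub N x y) e) *
            (\<integral>\<omega>. nabla \<epsilon> N l (\<lambda>z. \<psi> k s z \<omega>) y * nabla \<epsilon> N j (\<lambda>z. \<psi> k t z \<omega>) x \<partial>\<Omega>)
      = (heat_kernel \<kappa> (t - s) (?m (z - e)) * cov_kernel s (?m (z - ?u + unit_step j))
         - heat_kernel \<kappa> (t - s) (?m (z - e)) * cov_kernel s (?m (z - ?u))
         - heat_kernel \<kappa> (t - s) (?m (z - e)) * cov_kernel s (?m (z + unit_step j))
         + heat_kernel \<kappa> (t - s) (?m (z - e)) * cov_kernel s (?m z)) / \<epsilon>\<^sup>2"
      unfolding field_nabla_covariance(4)[OF k s x y z] ze
      by (simp add: algebra_simps diff_divide_distrib add_divide_distrib)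
  qed (use N in \<open>auto simp: heat_kernel_future\<close>)
  \<comment> \<open>With \<open>y\<close> as base point the other end of the edge sits at offset
    \<open>- unit_step l\<close>, whence the reflected form.\<close>
  have C: "(\<integral>\<omega>. \<psi> k t (tadd N y ?u) \<omega> * \<psi> k t y \<omega> \<partial>\<Omega>) = edge_cov l" if k: "k \<in> {1, 2}" for k
  proof -
    have "t \<in> {-T..t}" using t by simp
    from field_covariance[OF k this y, of "tadd N y ?u"] show ?thesis
      using N by (simp add: edge_cov_reflect tadd_eq_torus_mod tsub_eq_torus_mod)
  qed
  have "tsub N y x = ?m (- tsub N x y)"
    by (simp add: tsub_eq_torus_mod)
  then have D: "kronecker (tsub N y x) = kronecker (?m z)"
    by (simp add: z kronecker_torus_mod_minus)
  have AB: "(\<Sum>e\<in>{(0, 0), ?u}. \<Sum>k\<in>{1, 2::nat}. \<Sum>j\<in>{1, 2}.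
        ward_density j (z - e) (z - ?u) - ward_density j (z - e) z) / \<epsilon>\<^sup>2
     = - (\<Sum>e\<in>{(0, 0), ?u}. \<Sum>k\<in>{1, 2}. \<Sum>j\<in>{1, 2}.
          LBINT s:{-T..}. nabla \<epsilon> N j (heat_kernel \<kappa> (t - s)) (tsub N (tsub N x y) e) *
            (\<integral>\<omega>. nabla \<epsilon> N l (\<lambda>z. \<psi> k s z \<omega>) y * \<psi> k t x \<omega> \<partial>\<Omega>))
     + (\<Sum>e\<in>{(0, 0), ?u}. \<Sum>k\<in>{1, 2}. \<Sum>j\<in>{1, 2}.
          LBINT s:{-T..}. heat_kernel \<kappa> (t - s) (tsub N (tsub N x y) e) *
            (\<integral>\<omega>. nabla \<epsilon> N l (\<lambda>z. \<psi> k s z \<omega>) y * nabla \<epsilon> N j (\<lambda>z. \<psi> k t z \<omega>) x \<partial>\<Omega>))"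
    unfolding sum_negf[symmetric] sum.distrib[symmetric] sum_divide_distrib
    by (intro sum.cong refl, subst A, assumption, subst B, assumption)
      (simp add: ward_density_def diff_divide_distrib add_divide_distrib)
  have E: "(\<Sum>k\<in>{1, 2}. kronecker (tsub N y x) * (\<integral>\<omega>. \<psi> k t (tadd N y ?u) \<omega> * \<psi> k t y \<omega> \<partial>\<Omega>))
     = 2 * kronecker (?m z) * edge_cov l"
    using C D by simp
  have F: "(\<Sum>e\<in>{(0, 0), ?u}. \<Sum>k\<in>{1, 2::nat}. \<Sum>j\<in>{1, 2}.
        ward_density j (z - e) (z - ?u) - ward_density j (z - e) z) / \<epsilon>\<^sup>2
     = 2 / \<epsilon>\<^sup>2 * (\<Sum>j\<in>{1, 2}. \<Sum>e\<in>{(0, 0), ?u}. ward_density j (z - e) (z - ?u) - ward_density j (z - e) z)"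
    by (subst (2) sum.swap) (simp add: sum_distrib_left sum.distrib)
  show ?thesis
    unfolding ward_V_def E F[symmetric] AB by simp
qed

text \<open>All terms are expressed at \<open>z = x - y\<close>; moving \<open>y\<close> by a step
  moves \<open>z\<close> by the opposite one. What the divergence leaves beyond the Laplacian of
  \<open>U\<close> vanishes by \<open>ward_density_balance\<close> for each
  \<open>j\<close>.\<close>

lemma ward_identity:
  assumes x: "x \<in> torus N" and y: "y \<in> torus N"
  shows "divergence \<epsilon> N (ward_V \<Omega> \<epsilon> N T \<kappa> \<psi> t x) y - laplacian \<epsilon> N (ward_U \<Omega> \<epsilon> N T \<kappa> \<psi> t x) y = 0"
proof -
  define z where "z = x - y"
  have z: "tsub N x y = torus_mod N z"
    by (simp add: z_def tsub_eq_torus_mod)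
  have zs: "tsub N x (tsub N y w) = torus_mod N (z + w)" "tsub N x (tadd N y w) = torus_mod N (z - w)" for w
    by (simp_all add: z_def tadd_eq_torus_mod tsub_eq_torus_mod algebra_simps)
  have U: "ward_U \<Omega> \<epsilon> N T \<kappa> \<psi> t x y = 2 / \<epsilon> * (\<Sum>j\<in>{1, 2}. ward_density j z z)"
    by (rule ward_U_eq[OF x y z])
  have Us: "ward_U \<Omega> \<epsilon> N T \<kappa> \<psi> t x (tadd N y w) = 2 / \<epsilon> * (\<Sum>j\<in>{1, 2}. ward_density j (z - w) (z - w))" for w
    using N by (intro ward_U_eq[OF x _ zs(2)]) simp
  note V = ward_V_eq[OF x y z]
  have Vs: "ward_V \<Omega> \<epsilon> N T \<kappa> \<psi> t x l (tsub N y (unit_step l))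
      = - 2 * kronecker (torus_mod N (z + unit_step l)) * edge_cov l
    + 2 / \<epsilon>\<^sup>2 * (\<Sum>j\<in>{1, 2}. \<Sum>e\<in>{(0, 0), unit_step l}.
        ward_density j (z + unit_step l - e) z - ward_density j (z + unit_step l - e) (z + unit_step l))"
    if "l \<in> {1, 2}" for l
    using ward_V_eq[OF x _ zs(1) that, of "unit_step l"] N by simp
  note balance = ward_density_balance[of 1 z] ward_density_balance[of 2 z]
  \<comment> \<open>In coordinates, subtracting a step and adding its opposite give the same
    term.\<close>
  obtain p q where pq: "z = (p, q)" by fastforce
  define D1 where "D1 = ward_density 1"
  define D2 where "D2 = ward_density 2"
  have l: "(1::nat) \<in> {1, 2}" "(2::nat) \<in> {1, 2}" by simp_all
  have divergence: "divergence \<epsilon> N W y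
    = (W 1 y - W 1 (tsub N y (unit_step 1)) + (W 2 y - W 2 (tsub N y (unit_step 2)))) / \<epsilon>" for W
    by (simp add: divergence_def)
  let ?k = "\<lambda>z. kronecker (torus_mod N z)"
  have "divergence \<epsilon> N (ward_V \<Omega> \<epsilon> N T \<kappa> \<psi> t x) y - laplacian \<epsilon> N (ward_U \<Omega> \<epsilon> N T \<kappa> \<psi> t x) y
    = 2 / \<epsilon> * (((\<Sum>e\<in>{(1, 0), (-1, 0), (0, 1), (0, -1)}. D1 z (z + e) - D1 (z + e) z) / \<epsilon>\<^sup>2
                 - (?k z - ?k (z + unit_step 1)) * edge_cov 1)
              + ((\<Sum>e\<in>{(1, 0), (-1, 0), (0, 1), (0, -1)}. D2 z (z + e) - D2 (z + e) z) / \<epsilon>\<^sup>2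
                 - (?k z - ?k (z + unit_step 2)) * edge_cov 2))"
  proof -
    \<comment> \<open>The terms with both arguments shifted, together with the central ones, form
      the Laplacian of \<open>U\<close> with a positive sign; those with one shifted argument form
      the balance expression.\<close>
    have "divergence \<epsilon> N (ward_V \<Omega> \<epsilon> N T \<kappa> \<psi> t x) y = (
        - 2 * (?k z - ?k (z + unit_step 1)) * edge_cov 1 - 2 * (?k z - ?k (z + unit_step 2)) * edge_cov 2
        + 2 / \<epsilon>\<^sup>2 * (\<Sum>l\<in>{(1, 0), (0, 1)}.
            D1 z (z - l) - 2 * D1 z z + D1 (z - l) (z - l) - D1 (z - l) z - D1 (z + l) z + D1 (z + l) (z + l) + D1 z (z + l)
          + (D2 z (z - l) - 2 * D2 z z + D2 (z - l) (z - l) - D2 (z - l) z - D2 (z + l) z + D2 (z + l) (z + l) + D2 z (z + l)))) / \<epsilon>"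
      unfolding divergence D1_def D2_def V[OF l(1)] V[OF l(2)] Vs[OF l(1)] Vs[OF l(2)]
      by (simp add: unit_step_def pq) (simp add: algebra_simps diff_divide_distrib add_divide_distrib)
    moreover have "laplacian \<epsilon> N (ward_U \<Omega> \<epsilon> N T \<kappa> \<psi> t x) y = 2 / \<epsilon> * (\<Sum>l\<in>{(1, 0), (0, 1)}.
            D1 (z - l) (z - l) + D1 (z + l) (z + l) - 2 * D1 z z
          + (D2 (z - l) (z - l) + D2 (z + l) (z + l) - 2 * D2 z z)) / \<epsilon>\<^sup>2"
      unfolding laplacian_eq U Us D1_def D2_def
      by (simp add: pq) (simp add: algebra_simps diff_divide_distrib add_divide_distrib)
    ultimately show ?thesis
      by (simp add: pq unit_step_def) (simp add: algebra_simps diff_divide_distrib add_divide_distrib)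
  qed
  also have "\<dots> = 0"
    using balance by (simp add: D1_def D2_def)
  finally show ?thesis .
qed

end

theorem mainTheorem3:
  fixes \<Omega> :: "'w measure"
    and \<epsilon> M T t :: real
    and N :: nat
    and x :: site
    and \<kappa> :: "real \<Rightarrow> site \<Rightarrow> site pmf"
    and B :: "nat \<Rightarrow> site \<Rightarrow> real \<Rightarrow> 'w \<Rightarrow> real"
    and \<psi> :: "nat \<Rightarrow> real \<Rightarrow> site \<Rightarrow> 'w \<Rightarrow> real"
  assumes "prob_space \<Omega>"
    and "\<epsilon> > 0" and "M > 1" and "M = real N * \<epsilon>" and "T > 0"
    and "x \<in> torus N" and "t > - T"
    and "ctrw_transition \<epsilon> N \<kappa>"
    and "driving_noise \<Omega> \<epsilon> N (- T) B"
    and "stochastic_convolution \<Omega> N T \<kappa> B \<psi>"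
  shows "\<forall>y\<in>torus N.
           divergence \<epsilon> N (ward_V \<Omega> \<epsilon> N T \<kappa> \<psi> t x) y
           - laplacian \<epsilon> N (ward_U \<Omega> \<epsilon> N T \<kappa> \<psi> t x) y = 0"
proof
  fix y assume "y \<in> torus N"
  \<comment> \<open>A torus of side length above 1 has at least one site per direction.\<close>
  have "0 < N"
    using assms(3,4) by (cases "N = 0") auto
  then interpret ward_setting \<Omega> \<epsilon> T t N \<kappa> B \<psi>
    using assms by (intro ward_setting.intro ward_setting_axioms.intro)
  show "divergence \<epsilon> N (ward_V \<Omega> \<epsilon> N T \<kappa> \<psi> t x) y
    - laplacian \<epsilon> N (ward_U \<Omega> \<epsilon> N T \<kappa> \<psi> t x) y = 0"
    by (rule ward_identity) fact+
qed

end
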